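(* Let $\alpha,\beta\in\mathbb{K}^*$ be roots of unity with $\alpha\beta\neq1$, and let $\underline{\mu}=(\mu_1,\mu_2,\mu_3)$ and $\underline{\lambda}=(\lambda_1,\lambda_2,\lambda_3)$ be in $(\mathbb{K}^* )^3$. Then $\mathscr{V}_2(\underline{\mu})$ is isomorphic to $\mathscr{V}_2(\underline{\lambda})$ as $M_2(\alpha,\beta)$-modules if and only if $$\mu_1^{l_1}=\lambda_1^{l_1}\alpha^{-vl_1},\quad \mu_2^{l_2}=\lambda_2^{l_2}\alpha^{ul_2},\quad \mu_3=\lambda_3(\alpha\beta)^{u}(\alpha^{-1}\beta)^{v}$$ holds for some integers $u,v$ such that $u=0$ or $u=\operatorname{ord}(\alpha\beta)$, and $0\le v\le l_2-1$.
   Context: $\mathbb{K}$ is an algebraically closed field of arbitrary characteristic and $\mathbb{K}^*=\mathbb{K}\setminus\{0\}$; all modules are right modules. For a root of unity $\xi\in\mathbb{K}^*$, $\operatorname{ord}(\xi)$ is its order in the group $\mathbb{K}^*$. For $\alpha,\beta\in\mathbb{K}^*$, the two-parameter quantum matrix algebra $M_2(\alpha,\beta)$ is the associative unital $\mathbb{K}$-algebra generated by $X_{11},X_{12},X_{21},X_{22}$ subject to the relations $X_{12}X_{11}=\alpha X_{11}X_{12}$, $X_{22}X_{21}=\alpha X_{21}X_{22}$, $X_{21}X_{11}=\beta X_{11}X_{21}$, $X_{22}X_{12}=\beta X_{12}X_{22}$, $X_{21}X_{12}=\beta\alpha^{-1}X_{12}X_{21}$, $X_{22}X_{11}-X_{11}X_{22}=(\beta-\alpha^{-1})X_{12}X_{21}$.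 Set $l_1:=\operatorname{ord}(\alpha\beta)$ if $\operatorname{ord}(\beta)\mid\operatorname{ord}(\alpha\beta)\operatorname{ord}(\alpha\beta^{-1})$ and $l_1:=2\operatorname{ord}(\alpha\beta)$ otherwise; set $l_2:=\operatorname{ord}(\alpha\beta^{-1})$. $\mathscr{V}_2(\underline{\mu})$ is the $\mathbb{K}$-vector space with basis $\{e(a,b):0\le a\le l_1-1,\ 0\le b\le l_2-1\}$ and $M_2(\alpha,\beta)$-action (which does define a module structure) $$e(a,b)X_{11}=\begin{cases}\mu_1^{-1}\mu_3\alpha^{-1}(\alpha^{-1}\beta)^b[(\alpha\beta)^a-1]e(a-1,b)& a\neq0\\ 0& a=0\end{cases}$$ $$e(a,b)X_{12}=\mu_2^{-1}\mu_3\beta^a(\alpha^{-1}\beta)^be(a,b\dotplus(-1)),\qquad e(a,b)X_{21}=\mu_2\alpha^ae(a,b\dotplus1),$$ $$e(a,b)X_{22}=\begin{cases}\mu_1e(a+1,b)& a\neq l_1-1\\ \mu_1\alpha^{-bl_1}e(0,b)& a=l_1-1\end{cases}$$ where $\dotplus$ is addition modulo $l_2$. *)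

theory Defs
  imports "HOL-Algebra.Algebraic_Closure_Type" "HOL-Library.Poly_Mapping"
begin

(* Right modules over a not necessarily commutative ring. As in HOL-Algebra.Module,
   the record extends the ring record; only its additive part is used. *)

record ('r, 'm) rmodule = "'m ring" +
  ract :: "'m \<Rightarrow> 'r \<Rightarrow> 'm"

locale right_module = R?: ring R + M?: abelian_group M
    for R :: "('r, 'c) ring_scheme" (structure) and M :: "('r, 'm, 'd) rmodule_scheme" (structure) +
  assumes ract_closed: "\<lbrakk>x \<in> carrier M; r \<in> carrier R\<rbrakk> \<Longrightarrow> ract M x r \<in> carrier M"
    and ract_add_left: "\<lbrakk>x \<in> carrier M; y \<in> carrier M; r \<in> carrier R\<rbrakk> \<Longrightarrow>
      ract M (x \<oplus>\<^bsub>M\<^esub> y) r = ract M x r \<oplus>\<^bsub>M\<^esub> ract M y r"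
    and ract_add_right: "\<lbrakk>x \<in> carrier M; r \<in> carrier R; s \<in> carrier R\<rbrakk> \<Longrightarrow>
      ract M x (r \<oplus>\<^bsub>R\<^esub> s) = ract M x r \<oplus>\<^bsub>M\<^esub> ract M x s"
    and ract_mult: "\<lbrakk>x \<in> carrier M; r \<in> carrier R; s \<in> carrier R\<rbrakk> \<Longrightarrow>
      ract M x (r \<otimes>\<^bsub>R\<^esub> s) = ract M (ract M x r) s"
    and ract_one: "x \<in> carrier M \<Longrightarrow> ract M x \<one>\<^bsub>R\<^esub> = x"

definition rmod_hom ::
  "('r, 'c) ring_scheme \<Rightarrow> ('r, 'm, 'd) rmodule_scheme \<Rightarrow> ('r, 'n, 'e) rmodule_scheme \<Rightarrow> ('m \<Rightarrow> 'n) set"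
  where "rmod_hom R M N = {f \<in> carrier M \<rightarrow> carrier N.
    (\<forall>x\<in>carrier M. \<forall>y\<in>carrier M. f (x \<oplus>\<^bsub>M\<^esub> y) = f x \<oplus>\<^bsub>N\<^esub> f y) \<and>
    (\<forall>x\<in>carrier M. \<forall>r\<in>carrier R. f (ract M x r) = ract N (f x) r)}"

definition rmod_isomorphic ::
  "('r, 'c) ring_scheme \<Rightarrow> ('r, 'm, 'd) rmodule_scheme \<Rightarrow> ('r, 'n, 'e) rmodule_scheme \<Rightarrow> bool"
  where "rmod_isomorphic R M N \<longleftrightarrow> (\<exists>f \<in> rmod_hom R M N. bij_betw f (carrier M) (carrier N))"

(* 'b \<Rightarrow>\<^sub>0 'k is the vector space with basis the elements b of 'b, where b itself is
   Poly_Mapping.single b 1; lin_ext T is the linear map with values T b on the basis. *)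

definition pm_scale :: "'k::mult_zero \<Rightarrow> ('b \<Rightarrow>\<^sub>0 'k) \<Rightarrow> ('b \<Rightarrow>\<^sub>0 'k)" (infixr "*\<^sub>K" 75)
  where "c *\<^sub>K v = Poly_Mapping.map ((*) c) v"

definition lin_ext :: "('b \<Rightarrow> ('c \<Rightarrow>\<^sub>0 'k)) \<Rightarrow> ('b \<Rightarrow>\<^sub>0 'k) \<Rightarrow> ('c \<Rightarrow>\<^sub>0 'k::field)"
  where "lin_ext T v = (\<Sum>b\<in>Poly_Mapping.keys v. Poly_Mapping.lookup v b *\<^sub>K T b)"

(* The free monoid, written additively so that the convolution product of Poly_Mapping
   makes 'g word \<Rightarrow>\<^sub>0 'k the free associative unital 'k-algebra on 'g. *)

datatype 'g word = Word (letters: "'g list")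

instantiation word :: (type) monoid_add
begin

definition "0 = Word []"
definition "u + v = Word (letters u @ letters v)"

instance
  by standard (auto simp: zero_word_def plus_word_def)

end

datatype mat_gen = X11 | X12 | X21 | X22

type_synonym 'k free_mat_alg = "mat_gen word \<Rightarrow>\<^sub>0 'k"

definition var :: "mat_gen \<Rightarrow> 'k::field free_mat_alg"
  where "var g = Poly_Mapping.single (Word [g]) 1"

definition scalar :: "'k::field \<Rightarrow> 'k free_mat_alg"
  where "scalar c = Poly_Mapping.single 0 c"

definition M2_relations :: "'k::field \<Rightarrow> 'k \<Rightarrow> 'k free_mat_alg set"
  where "M2_relations \<alpha> \<beta> =
    {var X12 * var X11 - scalar \<alpha> * var X11 * var X12,
     var X22 * var X21 - scalar \<alpha> * var X21 * var X22,
     var X21 * var X11 - scalar \<beta> * var X11 * var X21,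
     var X22 * var X12 - scalar \<beta> * var X12 * var X22,
     var X21 * var X12 - scalar (\<beta> * inverse \<alpha>) * var X12 * var X21,
     var X22 * var X11 - var X11 * var X22 - scalar (\<beta> - inverse \<alpha>) * var X12 * var X21}"

definition M2 :: "'k::field \<Rightarrow> 'k \<Rightarrow> 'k free_mat_alg set ring"
  where "M2 \<alpha> \<beta> =
    ring_of_type_algebra Quot (Idl\<^bsub>ring_of_type_algebra\<^esub> (M2_relations \<alpha> \<beta>))"

(* group.ord is 0 on elements of infinite order; it is only used here at roots of unity.
   Ring_Divisibility also has a mult_of, hence the qualified name. *)

definition mult_ord :: "'k::field \<Rightarrow> nat"
  where "mult_ord \<xi> = group.ord (Multiplicative_Group.mult_of ring_of_type_algebra) \<xi>"

definition root_of_unity :: "'k::field \<Rightarrow> bool"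
  where "root_of_unity \<xi> \<longleftrightarrow> (\<exists>n>0. \<xi> ^ n = 1)"

definition l1 :: "'k::field \<Rightarrow> 'k \<Rightarrow> nat"
  where "l1 \<alpha> \<beta> =
    (if mult_ord \<beta> dvd mult_ord (\<alpha> * \<beta>) * mult_ord (\<alpha> * inverse \<beta>)
     then mult_ord (\<alpha> * \<beta>) else 2 * mult_ord (\<alpha> * \<beta>))"

definition l2 :: "'k::field \<Rightarrow> 'k \<Rightarrow> nat"
  where "l2 \<alpha> \<beta> = mult_ord (\<alpha> * inverse \<beta>)"

definition cyc_add :: "nat \<Rightarrow> nat \<Rightarrow> int \<Rightarrow> nat"
  where "cyc_add l b k = nat ((int b + k) mod int l)"

definition basis_e :: "nat \<Rightarrow> nat \<Rightarrow> (nat \<times> nat \<Rightarrow>\<^sub>0 'k::field)"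
  where "basis_e a b = Poly_Mapping.single (a, b) 1"

fun V2_gen :: "'k::field \<Rightarrow> 'k \<Rightarrow> 'k \<Rightarrow> 'k \<Rightarrow> 'k \<Rightarrow> mat_gen \<Rightarrow> nat \<times> nat \<Rightarrow> (nat \<times> nat \<Rightarrow>\<^sub>0 'k)"
  where
    "V2_gen \<alpha> \<beta> \<mu>1 \<mu>2 \<mu>3 X11 (a, b) =
      (if a \<noteq> 0
       then (inverse \<mu>1 * \<mu>3 * inverse \<alpha> * (inverse \<alpha> * \<beta>) ^ b * ((\<alpha> * \<beta>) ^ a - 1)) *\<^sub>K basis_e (a - 1) b
       else 0)"
  | "V2_gen \<alpha> \<beta> \<mu>1 \<mu>2 \<mu>3 X12 (a, b) =
      (inverse \<mu>2 * \<mu>3 * \<beta> ^ a * (inverse \<alpha> * \<beta>) ^ b) *\<^sub>K basis_e a (cyc_add (l2 \<alpha> \<beta>) b (-1))"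
  | "V2_gen \<alpha> \<beta> \<mu>1 \<mu>2 \<mu>3 X21 (a, b) =
      (\<mu>2 * \<alpha> ^ a) *\<^sub>K basis_e a (cyc_add (l2 \<alpha> \<beta>) b 1)"
  | "V2_gen \<alpha> \<beta> \<mu>1 \<mu>2 \<mu>3 X22 (a, b) =
      (if a \<noteq> l1 \<alpha> \<beta> - 1
       then \<mu>1 *\<^sub>K basis_e (a + 1) b
       else (\<mu>1 * \<alpha> powi (- int (b * l1 \<alpha> \<beta>))) *\<^sub>K basis_e 0 b)"

(* v X_(i1) ... X_(in): the leftmost letter acts first, since modules are right modules. *)

definition V2_word ::
  "'k::field \<Rightarrow> 'k \<Rightarrow> 'k \<Rightarrow> 'k \<Rightarrow> 'k \<Rightarrow> (nat \<times> nat \<Rightarrow>\<^sub>0 'k) \<Rightarrow> mat_gen word \<Rightarrow> (nat \<times> nat \<Rightarrow>\<^sub>0 'k)"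
  where "V2_word \<alpha> \<beta> \<mu>1 \<mu>2 \<mu>3 v w =
    fold (\<lambda>g. lin_ext (V2_gen \<alpha> \<beta> \<mu>1 \<mu>2 \<mu>3 g)) (letters w) v"

definition V2_free ::
  "'k::field \<Rightarrow> 'k \<Rightarrow> 'k \<Rightarrow> 'k \<Rightarrow> 'k \<Rightarrow> (nat \<times> nat \<Rightarrow>\<^sub>0 'k) \<Rightarrow> 'k free_mat_alg \<Rightarrow> (nat \<times> nat \<Rightarrow>\<^sub>0 'k)"
  where "V2_free \<alpha> \<beta> \<mu>1 \<mu>2 \<mu>3 v = lin_ext (V2_word \<alpha> \<beta> \<mu>1 \<mu>2 \<mu>3 v)"

definition V2_carrier :: "'k::field \<Rightarrow> 'k \<Rightarrow> (nat \<times> nat \<Rightarrow>\<^sub>0 'k) set"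
  where "V2_carrier \<alpha> \<beta> = {v. Poly_Mapping.keys v \<subseteq> {..<l1 \<alpha> \<beta>} \<times> {..<l2 \<alpha> \<beta>}}"

(* An element C of M2 \<alpha> \<beta> is a coset of the ideal of relations; by V2_ract_coset below
   all its members act in the same way on V2, so that the_elem picks their common value.
   The class of scalar c acts as multiplication by c (V2_ract_coset, V2_free_scalar), hence
   M2-module homomorphisms are automatically linear over 'k. *)

definition V2 ::
  "'k::field \<Rightarrow> 'k \<Rightarrow> 'k \<Rightarrow> 'k \<Rightarrow> 'k \<Rightarrow> ('k free_mat_alg set, nat \<times> nat \<Rightarrow>\<^sub>0 'k) rmodule"
  where "V2 \<alpha> \<beta> \<mu>1 \<mu>2 \<mu>3 =
    \<lparr>carrier = V2_carrier \<alpha> \<beta>, monoid.mult = undefined, one = undefined, ring.zero = 0, add = (+),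
     ract = (\<lambda>v C. the_elem (V2_free \<alpha> \<beta> \<mu>1 \<mu>2 \<mu>3 v ` C))\<rparr>"


lemma mult_ord_dvd_iff:
  fixes \<xi> :: "'k::field"
  assumes "\<xi> \<noteq> 0"
  shows "mult_ord \<xi> dvd n \<longleftrightarrow> \<xi> ^ n = 1"
proof -
  let ?R = "ring_of_type_algebra :: 'k ring"
  have "field ?R" by (rule field_from_type_algebra)
  then have G: "group (Multiplicative_Group.mult_of ?R)" by (rule field.field_mult_group)
  then interpret group "Multiplicative_Group.mult_of ?R" .
  have "\<xi> [^]\<^bsub>Multiplicative_Group.mult_of ?R\<^esub> n = \<xi> ^ n"
    by (induction n) (simp_all add: ring_of_type_algebra_def mult.commute)
  then show ?thesis
    using pow_eq_id[of \<xi> n] assms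
    by (simp add: mult_ord_def ring_of_type_algebra_def)
qed

lemma root_of_unity_nonzero: "root_of_unity \<xi> \<Longrightarrow> \<xi> \<noteq> 0"
  by (auto simp: root_of_unity_def power_0_left)

lemma mult_ord_pos:
  assumes "root_of_unity \<xi>"
  shows "0 < mult_ord \<xi>"
proof -
  obtain n where "n > 0" "\<xi> ^ n = 1" using assms by (auto simp: root_of_unity_def)
  then have "mult_ord \<xi> dvd n"
    by (simp add: mult_ord_dvd_iff[OF root_of_unity_nonzero[OF assms]])
  then show ?thesis using \<open>n > 0\<close> by (rule dvd_pos_nat[rotated])
qed

lemma root_of_unity_mult:
  assumes "root_of_unity \<xi>" "root_of_unity \<zeta>"
  shows "root_of_unity (\<xi> * \<zeta>)"
proof -
  obtain m n where mn: "m > 0" "n > 0" and 1: "\<xi> ^ m = 1" "\<zeta> ^ n = 1"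
    using assms by (auto simp: root_of_unity_def)
  have "(\<xi> * \<zeta>) ^ (m * n) = (\<xi> ^ m) ^ n * (\<zeta> ^ n) ^ m"
    by (simp only: power_mult_distrib power_mult[symmetric] mult.commute[of n m])
  then show ?thesis unfolding root_of_unity_def using mn 1 by (intro exI[of _ "m * n"]) simp
qed

lemma root_of_unity_inverse: "root_of_unity \<xi> \<Longrightarrow> root_of_unity (inverse \<xi>)"
  unfolding root_of_unity_def by (auto simp: power_inverse)

lemma lookup_pm_scale [simp]: "Poly_Mapping.lookup (c *\<^sub>K v) b = c * Poly_Mapping.lookup v b"
  by (simp add: pm_scale_def Poly_Mapping.map.rep_eq when_def)

lemma pm_scale_simps:
  fixes c d :: "'k::field"
  shows "c *\<^sub>K (u + v) = c *\<^sub>K u + c *\<^sub>K v" "(c + d) *\<^sub>K v = c *\<^sub>K v + d *\<^sub>K v"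
    "c *\<^sub>K d *\<^sub>K v = (c * d) *\<^sub>K v" "c *\<^sub>K 0 = 0" "0 *\<^sub>K v = 0" "1 *\<^sub>K v = v"
    "c *\<^sub>K Poly_Mapping.single b d = Poly_Mapping.single b (c * d)"
    "c *\<^sub>K sum f A = (\<Sum>x\<in>A. c *\<^sub>K f x)"
  by (rule poly_mapping_eqI;
      simp add: lookup_add lookup_sum algebra_simps sum_distrib_left lookup_single when_def)+

lemma lin_ext_superset:
  assumes "finite A" "Poly_Mapping.keys v \<subseteq> A"
  shows "lin_ext T v = (\<Sum>b\<in>A. Poly_Mapping.lookup v b *\<^sub>K T b)"
  unfolding lin_ext_def
  by (rule sum.mono_neutral_left) (use assms in \<open>auto simp: in_keys_iff pm_scale_simps\<close>)

lemma lin_ext_add: "lin_ext T (u + v) = lin_ext T u + lin_ext T v"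
proof -
  let ?A = "Poly_Mapping.keys u \<union> Poly_Mapping.keys v"
  have "Poly_Mapping.keys (u + v) \<subseteq> ?A" by (rule Poly_Mapping.keys_add)
  then show ?thesis
    by (simp add: lin_ext_superset[of ?A] lookup_add pm_scale_simps sum.distrib)
qed

lemma lin_ext_zero [simp]: "lin_ext T 0 = 0"
  by (simp add: lin_ext_def)

lemma lin_ext_scale: "lin_ext T (c *\<^sub>K v) = c *\<^sub>K lin_ext T v"
proof -
  have "Poly_Mapping.keys (c *\<^sub>K v) \<subseteq> Poly_Mapping.keys v"
    by (auto simp: in_keys_iff)
  then show ?thesis
    by (simp add: lin_ext_superset[of "Poly_Mapping.keys v"] pm_scale_simps)
qed

lemma lin_ext_single [simp]: "lin_ext T (Poly_Mapping.single b c) = c *\<^sub>K T b"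
  by (cases "c = 0") (simp_all add: lin_ext_def pm_scale_simps)

lemma lin_ext_sum: "lin_ext T (sum f A) = (\<Sum>x\<in>A. lin_ext T (f x))"
  by (induction A rule: infinite_finite_induct) (simp_all add: lin_ext_add)

lemma pm_scale_minus: "(-1::'k::field) *\<^sub>K v = - v"
  by (rule poly_mapping_eqI) simp

lemma lin_ext_uminus: "lin_ext T (- v) = - lin_ext T v"
  using lin_ext_scale[of T "-1" v] by (simp add: pm_scale_minus)

lemma lin_ext_diff: "lin_ext T (u - v) = lin_ext T u - lin_ext T v"
  using lin_ext_add[of T u "- v"] by (simp add: lin_ext_uminus)

lemma pm_expand: "v = (\<Sum>b\<in>Poly_Mapping.keys v. Poly_Mapping.single b (Poly_Mapping.lookup v b))"
  for v :: "'b \<Rightarrow>\<^sub>0 'k::field"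
  by (rule poly_mapping_eqI)
    (auto simp: lookup_sum lookup_single when_def in_keys_iff)

lemma V2_word_add: "V2_word \<alpha> \<beta> \<mu>1 \<mu>2 \<mu>3 (u + v) w = V2_word \<alpha> \<beta> \<mu>1 \<mu>2 \<mu>3 u w + V2_word \<alpha> \<beta> \<mu>1 \<mu>2 \<mu>3 v w"
proof -
  have "fold (\<lambda>g. lin_ext (V2_gen \<alpha> \<beta> \<mu>1 \<mu>2 \<mu>3 g)) xs (u + v)
    = fold (\<lambda>g. lin_ext (V2_gen \<alpha> \<beta> \<mu>1 \<mu>2 \<mu>3 g)) xs u + fold (\<lambda>g. lin_ext (V2_gen \<alpha> \<beta> \<mu>1 \<mu>2 \<mu>3 g)) xs v" for xs
    by (induction xs arbitrary: u v) (simp_all add: lin_ext_add)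
  then show ?thesis by (simp add: V2_word_def)
qed

lemma V2_word_scale: "V2_word \<alpha> \<beta> \<mu>1 \<mu>2 \<mu>3 (c *\<^sub>K v) w = c *\<^sub>K V2_word \<alpha> \<beta> \<mu>1 \<mu>2 \<mu>3 v w"
proof -
  have "fold (\<lambda>g. lin_ext (V2_gen \<alpha> \<beta> \<mu>1 \<mu>2 \<mu>3 g)) xs (c *\<^sub>K v)
    = c *\<^sub>K fold (\<lambda>g. lin_ext (V2_gen \<alpha> \<beta> \<mu>1 \<mu>2 \<mu>3 g)) xs v" for xs
    by (induction xs arbitrary: v) (simp_all add: lin_ext_scale)
  then show ?thesis by (simp add: V2_word_def)
qed

lemma V2_word_zero: "V2_word \<alpha> \<beta> \<mu>1 \<mu>2 \<mu>3 0 w = 0"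
  using V2_word_scale[of \<alpha> \<beta> \<mu>1 \<mu>2 \<mu>3 0 0 w] by (simp add: pm_scale_simps)

lemma V2_word_sum: "V2_word \<alpha> \<beta> \<mu>1 \<mu>2 \<mu>3 (sum f A) w = (\<Sum>x\<in>A. V2_word \<alpha> \<beta> \<mu>1 \<mu>2 \<mu>3 (f x) w)"
  by (induction A rule: infinite_finite_induct) (simp_all add: V2_word_add V2_word_zero)

lemma V2_word_plus:
  "V2_word \<alpha> \<beta> \<mu>1 \<mu>2 \<mu>3 v (w + w') = V2_word \<alpha> \<beta> \<mu>1 \<mu>2 \<mu>3 (V2_word \<alpha> \<beta> \<mu>1 \<mu>2 \<mu>3 v w) w'"
  by (simp add: V2_word_def plus_word_def)

lemma V2_free_add_left:
  "V2_free \<alpha> \<beta> \<mu>1 \<mu>2 \<mu>3 (u + v) f = V2_free \<alpha> \<beta> \<mu>1 \<mu>2 \<mu>3 u f + V2_free \<alpha> \<beta> \<mu>1 \<mu>2 \<mu>3 v f"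
  by (simp add: V2_free_def lin_ext_def V2_word_add pm_scale_simps sum.distrib)

lemma V2_free_scale_left:
  "V2_free \<alpha> \<beta> \<mu>1 \<mu>2 \<mu>3 (c *\<^sub>K v) f = c *\<^sub>K V2_free \<alpha> \<beta> \<mu>1 \<mu>2 \<mu>3 v f"
  by (simp add: V2_free_def lin_ext_def V2_word_scale pm_scale_simps mult.commute)

lemma V2_free_add_right:
  "V2_free \<alpha> \<beta> \<mu>1 \<mu>2 \<mu>3 v (f + g) = V2_free \<alpha> \<beta> \<mu>1 \<mu>2 \<mu>3 v f + V2_free \<alpha> \<beta> \<mu>1 \<mu>2 \<mu>3 v g"
  by (simp add: V2_free_def lin_ext_add)

lemma V2_free_zero_left [simp]: "V2_free \<alpha> \<beta> \<mu>1 \<mu>2 \<mu>3 0 f = 0"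
  by (simp add: V2_free_def lin_ext_def V2_word_zero pm_scale_simps)

lemma V2_free_sum_left:
  "V2_free \<alpha> \<beta> \<mu>1 \<mu>2 \<mu>3 (sum h A) f = (\<Sum>x\<in>A. V2_free \<alpha> \<beta> \<mu>1 \<mu>2 \<mu>3 (h x) f)"
  by (induction A rule: infinite_finite_induct) (simp_all add: V2_free_add_left)

lemma V2_free_mult:
  fixes f g :: "'k::field free_mat_alg"
  shows "V2_free \<alpha> \<beta> \<mu>1 \<mu>2 \<mu>3 v (f * g) = V2_free \<alpha> \<beta> \<mu>1 \<mu>2 \<mu>3 (V2_free \<alpha> \<beta> \<mu>1 \<mu>2 \<mu>3 v f) g"
proof -
  let ?W = "V2_word \<alpha> \<beta> \<mu>1 \<mu>2 \<mu>3" and ?lk = "Poly_Mapping.lookup"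
  have "f * g = (\<Sum>p\<in>Poly_Mapping.keys f. \<Sum>q\<in>Poly_Mapping.keys g.
      Poly_Mapping.single (p + q) (?lk f p * ?lk g q))"
    using arg_cong2[OF pm_expand[of f] pm_expand[of g], of "(*)"]
    by (simp only: sum_product mult_single)
  then have "V2_free \<alpha> \<beta> \<mu>1 \<mu>2 \<mu>3 v (f * g) = (\<Sum>p\<in>Poly_Mapping.keys f. \<Sum>q\<in>Poly_Mapping.keys g.
      (?lk f p * ?lk g q) *\<^sub>K ?W (?W v p) q)"
    by (simp add: V2_free_def lin_ext_sum V2_word_plus)
  also have "\<dots> = (\<Sum>q\<in>Poly_Mapping.keys g. \<Sum>p\<in>Poly_Mapping.keys f.
      (?lk f p * ?lk g q) *\<^sub>K ?W (?W v p) q)"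
    by (rule sum.swap)
  also have "\<dots> = V2_free \<alpha> \<beta> \<mu>1 \<mu>2 \<mu>3 (V2_free \<alpha> \<beta> \<mu>1 \<mu>2 \<mu>3 v f) g"
    by (simp add: V2_free_def lin_ext_def V2_word_sum V2_word_scale pm_scale_simps mult.commute)
  finally show ?thesis .
qed

lemma V2_free_var:
  "V2_free \<alpha> \<beta> \<mu>1 \<mu>2 \<mu>3 v (var g) = lin_ext (V2_gen \<alpha> \<beta> \<mu>1 \<mu>2 \<mu>3 g) v"
  by (simp add: V2_free_def var_def V2_word_def pm_scale_simps)

lemma V2_free_scalar: "V2_free \<alpha> \<beta> \<mu>1 \<mu>2 \<mu>3 v (scalar c) = c *\<^sub>K v"
  by (simp add: V2_free_def scalar_def V2_word_def zero_word_def)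

lemma V2_free_diff_right:
  "V2_free \<alpha> \<beta> \<mu>1 \<mu>2 \<mu>3 v (f - g) = V2_free \<alpha> \<beta> \<mu>1 \<mu>2 \<mu>3 v f - V2_free \<alpha> \<beta> \<mu>1 \<mu>2 \<mu>3 v g"
  by (simp add: V2_free_def lin_ext_diff)

lemmas V2_free_simps = V2_free_add_left V2_free_add_right V2_free_mult V2_free_var
  V2_free_scalar V2_free_diff_right V2_free_scale_left

context
  fixes \<alpha> \<beta> :: "'k::field"
  assumes \<alpha>: "root_of_unity \<alpha>" and \<beta>: "root_of_unity \<beta>"
begin

lemma params_nonzero: "\<alpha> \<noteq> 0" "\<beta> \<noteq> 0"
  using \<alpha> \<beta> by (auto dest: root_of_unity_nonzero)

lemma l2_pos: "0 < l2 \<alpha> \<beta>"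
  unfolding l2_def by (intro mult_ord_pos root_of_unity_mult root_of_unity_inverse \<alpha> \<beta>)

lemma l1_pos: "0 < l1 \<alpha> \<beta>"
  unfolding l1_def using mult_ord_pos[OF root_of_unity_mult[OF \<alpha> \<beta>]] by simp

lemma pow_l2: "(inverse \<alpha> * \<beta>) ^ l2 \<alpha> \<beta> = 1"
proof -
  have "(\<alpha> * inverse \<beta>) ^ l2 \<alpha> \<beta> = 1"
    unfolding l2_def using params_nonzero by (subst mult_ord_dvd_iff[symmetric]) auto
  moreover have "inverse \<alpha> * \<beta> = inverse (\<alpha> * inverse \<beta>)" by simp
  ultimately show ?thesis by (simp only: power_inverse inverse_1)
qed

lemma pow_l1: "(\<alpha> * \<beta>) ^ l1 \<alpha> \<beta> = 1"
  using params_nonzero by (subst mult_ord_dvd_iff[symmetric]) (auto simp: l1_def)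

lemma pow_ab: "\<alpha> ^ (l1 \<alpha> \<beta> * l2 \<alpha> \<beta>) = 1" "\<beta> ^ (l1 \<alpha> \<beta> * l2 \<alpha> \<beta>) = 1"
proof -
  let ?l = "mult_ord (\<alpha> * \<beta>)" and ?m = "l2 \<alpha> \<beta>"
  have 1: "(\<alpha> * \<beta>) ^ ?l = 1"
    using params_nonzero by (subst mult_ord_dvd_iff[symmetric]) auto
  have A: "\<alpha> ^ (?l * ?m) * \<beta> ^ (?l * ?m) = 1"
    using 1 by (simp only: power_mult_distrib[symmetric] power_mult power_one)
  have "(inverse \<alpha> * \<beta>) ^ (?m * ?l) = 1"
    by (simp add: power_mult pow_l2)
  then have B: "\<alpha> ^ (?l * ?m) = \<beta> ^ (?l * ?m)"
    using params_nonzero by (simp add: power_mult_distrib power_inverse field_simps)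
  show b: "\<beta> ^ (l1 \<alpha> \<beta> * l2 \<alpha> \<beta>) = 1"
  proof (cases "mult_ord \<beta> dvd ?l * ?m")
    case True
    then show ?thesis using params_nonzero by (simp add: l1_def l2_def mult_ord_dvd_iff)
  next
    case False
    have "\<beta> ^ (l1 \<alpha> \<beta> * l2 \<alpha> \<beta>) = \<beta> ^ (?l * ?m) * \<beta> ^ (?l * ?m)"
      using False by (simp add: l1_def l2_def power_add[symmetric] mult_2 algebra_simps)
    then show ?thesis using A B by simp
  qed
  have "(\<alpha> * \<beta>) ^ (l1 \<alpha> \<beta> * l2 \<alpha> \<beta>) = 1" by (simp add: power_mult pow_l1)
  then show "\<alpha> ^ (l1 \<alpha> \<beta> * l2 \<alpha> \<beta>) = 1" using b by (simp add: power_mult_distrib)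
qed

lemma cyc_add_less: "cyc_add (l2 \<alpha> \<beta>) b k < l2 \<alpha> \<beta>"
  using l2_pos by (simp add: cyc_add_def nat_less_iff)

lemma cyc_add_1:
  assumes "b < l2 \<alpha> \<beta>"
  shows "cyc_add (l2 \<alpha> \<beta>) b 1 = (if Suc b = l2 \<alpha> \<beta> then 0 else Suc b)"
proof -
  have "cyc_add (l2 \<alpha> \<beta>) b 1 = Suc b mod l2 \<alpha> \<beta>"
    unfolding cyc_add_def by (simp add: nat_mod_distrib nat_add_distrib)
  then show ?thesis using assms by auto
qed

lemma cyc_add_m1: "b < l2 \<alpha> \<beta> \<Longrightarrow> cyc_add (l2 \<alpha> \<beta>) b (-1) = (if b = 0 then l2 \<alpha> \<beta> - 1 else b - 1)"
  by (auto simp: cyc_add_def mod_pos_pos_trivial zmod_minus1 nat_diff_distrib)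

lemma cyc_add_cancel:
  assumes "b < l2 \<alpha> \<beta>"
  shows "cyc_add (l2 \<alpha> \<beta>) (cyc_add (l2 \<alpha> \<beta>) b 1) (-1) = b"
    and "cyc_add (l2 \<alpha> \<beta>) (cyc_add (l2 \<alpha> \<beta>) b (-1)) 1 = b"
  using assms cyc_add_less[of b 1] cyc_add_less[of b "-1"]
  by (auto simp: cyc_add_1 cyc_add_m1)

lemma pow_cyc_add:
  fixes x :: 'k
  assumes "b < l2 \<alpha> \<beta>" "x ^ l2 \<alpha> \<beta> = 1"
  shows "x ^ cyc_add (l2 \<alpha> \<beta>) b 1 = x ^ b * x"
    and "x ^ cyc_add (l2 \<alpha> \<beta>) b (-1) = x ^ b * inverse x"
proof -
  have x0: "x \<noteq> 0" using assms l2_pos by (auto simp: power_0_left)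
  have *: "x ^ cyc_add (l2 \<alpha> \<beta>) b 1 = x ^ b * x" if "b < l2 \<alpha> \<beta>" for b
    using that assms(2) by (auto simp: cyc_add_1 mult.commute simp flip: power_Suc)
  show "x ^ cyc_add (l2 \<alpha> \<beta>) b 1 = x ^ b * x" by (rule *) (rule assms)
  show "x ^ cyc_add (l2 \<alpha> \<beta>) b (-1) = x ^ b * inverse x"
    using *[OF cyc_add_less, of b "-1"] x0 by (simp add: cyc_add_cancel assms(1))
qed

lemma V2_relations_basis:
  assumes ab: "a < l1 \<alpha> \<beta>" "b < l2 \<alpha> \<beta>" and f: "f \<in> M2_relations \<alpha> \<beta>"
    and \<mu>: "\<mu>1 \<noteq> 0" "\<mu>2 \<noteq> 0"
  shows "V2_free \<alpha> \<beta> \<mu>1 \<mu>2 \<mu>3 (basis_e a b) f = 0"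
proof -
  define q s where "q = inverse \<alpha> * \<beta>" and "s = inverse (\<alpha> ^ l1 \<alpha> \<beta>)"
  have ql: "q ^ l2 \<alpha> \<beta> = 1" by (simp add: q_def pow_l2)
  have sl: "s ^ l2 \<alpha> \<beta> = 1"
    using pow_ab(1) by (simp add: s_def power_inverse power_mult[symmetric])
  have powi_s: "\<alpha> powi (- int (b * l1 \<alpha> \<beta>)) = s ^ b" for b
    by (simp only: s_def power_int_minus power_int_of_nat power_inverse power_mult[symmetric] mult.commute)
  have nz: "\<alpha> \<noteq> 0" "\<beta> \<noteq> 0" "q \<noteq> 0" "s \<noteq> 0"
    using params_nonzero by (simp_all add: q_def s_def)
  have \<beta>_eq: "\<beta> = \<alpha> * q" using nz by (simp add: q_def)
  obtain n where n: "l1 \<alpha> \<beta> = Suc n" using l1_pos gr0_implies_Suc by blast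
  have pn: "\<alpha> * \<alpha> ^ n * \<alpha> * \<alpha> ^ n * q * q ^ n = 1" and s_eq: "s = inverse (\<alpha> * \<alpha> ^ n)"
    using pow_l1 unfolding n s_def by (simp_all add: \<beta>_eq power_mult_distrib mult_ac)
  have qn: "q ^ n = inverse (\<alpha> * \<alpha> ^ n * \<alpha> * \<alpha> ^ n * q)"
    using inverse_unique[OF pn] by (rule sym)
  define dn up nx where "dn = (\<lambda>b. cyc_add (l2 \<alpha> \<beta>) b (-1))"
    and "up = (\<lambda>b. cyc_add (l2 \<alpha> \<beta>) b 1)" and "nx = (\<lambda>a. if a = n then 0 else Suc a)"
  have cyc: "dn (up b) = b" "up (dn b) = b" "q ^ up b = q ^ b * q" "q ^ dn b = q ^ b * inverse q"
    "s ^ up b = s ^ b * s" "s ^ dn b = s ^ b * inverse s"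
    using cyc_add_cancel[OF ab(2)] pow_cyc_add[OF ab(2) ql] pow_cyc_add[OF ab(2) sl]
    by (simp_all add: dn_def up_def)
  let ?T = "V2_gen \<alpha> \<beta> \<mu>1 \<mu>2 \<mu>3" and ?s = "\<lambda>a b. Poly_Mapping.single (a :: nat, b :: nat) :: 'k \<Rightarrow> _"
  have G: "lin_ext (?T X11) (?s a b c) =
        ?s (a - 1) b (c * (inverse \<mu>1 * \<mu>3 * inverse \<alpha> * q ^ b * ((\<alpha> * \<alpha> * q) ^ a - 1)))"
      "lin_ext (?T X12) (?s a b c) = ?s a (dn b) (c * (inverse \<mu>2 * \<mu>3 * (\<alpha> * q) ^ a * q ^ b))"
      "lin_ext (?T X21) (?s a b c) = ?s a (up b) (c * (\<mu>2 * \<alpha> ^ a))"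
      "lin_ext (?T X22) (?s a b c) = ?s (nx a) b (c * (if a = n then \<mu>1 * s ^ b else \<mu>1))" for a b c
  proof -
    show "lin_ext (?T X22) (?s a b c) = ?s (nx a) b (c * (if a = n then \<mu>1 * s ^ b else \<mu>1))"
      unfolding lin_ext_single V2_gen.simps powi_s by (simp add: n nx_def basis_e_def pm_scale_simps)
  qed (simp_all add: basis_e_def pm_scale_simps dn_def up_def q_def[symmetric] \<beta>_eq[symmetric] mult.assoc)
  note S = V2_free_simps basis_e_def lin_ext_scale pm_scale_simps G cyc
  have R: "\<beta> * inverse \<alpha> = q" "\<beta> - inverse \<alpha> = \<alpha> * q - inverse \<alpha>"
    by (simp add: q_def mult.commute) (simp add: \<beta>_eq[symmetric])
  from f consider
      "f = var X12 * var X11 - scalar \<alpha> * var X11 * var X12"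
    | "f = var X22 * var X21 - scalar \<alpha> * var X21 * var X22"
    | "f = var X21 * var X11 - scalar \<beta> * var X11 * var X21"
    | "f = var X22 * var X12 - scalar \<beta> * var X12 * var X22"
    | "f = var X21 * var X12 - scalar (\<beta> * inverse \<alpha>) * var X12 * var X21"
    | "f = var X22 * var X11 - var X11 * var X22 - scalar (\<beta> - inverse \<alpha>) * var X12 * var X21"
    unfolding M2_relations_def by blast
  then show ?thesis
  proof cases
    case 1
    show ?thesis unfolding 1 S unfolding \<beta>_eq using nz \<mu>
      by (cases a) (simp_all add: nx_def s_eq single_diff[symmetric] field_simps power_mult_distrib)
  next
    case 2
    show ?thesis unfolding 2 S unfolding \<beta>_eq using nz \<mu>
      by (simp add: nx_def s_eq single_diff[symmetric] field_simps power_mult_distrib)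
  next
    case 3
    show ?thesis unfolding 3 S unfolding \<beta>_eq using nz \<mu>
      by (cases a) (simp_all add: nx_def s_eq single_diff[symmetric] field_simps power_mult_distrib)
  next
    case 4
    show ?thesis unfolding 4 S unfolding \<beta>_eq using nz \<mu>
      by (simp add: qn nx_def s_eq single_diff[symmetric] field_simps power_mult_distrib)
  next
    case 5
    show ?thesis unfolding 5 S unfolding R using nz \<mu>
      by (simp add: nx_def s_eq single_diff[symmetric] field_simps power_mult_distrib)
  next
    case 6
    let ?P = "\<alpha> * \<alpha> * q"
    have P: "?P * ?P ^ n = 1" using pn by (simp add: power_mult_distrib mult_ac)
    have A: "lin_ext (?T X11) (lin_ext (?T X22) (?s a b 1)) =
        ?s a b (\<mu>3 * inverse \<alpha> * q ^ b * (?P ^ Suc a - 1))"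
      using \<mu> P unfolding G by (simp add: nx_def mult.assoc[symmetric])
    have B: "lin_ext (?T X22) (lin_ext (?T X11) (?s a b 1)) =
        ?s a b (\<mu>3 * inverse \<alpha> * q ^ b * (?P ^ a - 1))"
    proof -
      have M: "inverse \<mu>1 * \<mu>3 * x * y * z * \<mu>1 = \<mu>3 * x * y * z" for x y z
        using \<mu> by (simp add: field_simps)
      show ?thesis using ab(1) unfolding G by (cases a) (simp_all add: nx_def n M)
    qed
    have C: "lin_ext (?T X21) (lin_ext (?T X12) (?s a b 1)) = ?s a b (\<mu>3 * ?P ^ a * q ^ b)"
      using \<mu> unfolding G cyc by (simp add: power_mult_distrib field_simps)
    have "V2_free \<alpha> \<beta> \<mu>1 \<mu>2 \<mu>3 (basis_e a b) f = ?s a b (\<mu>3 * inverse \<alpha> * q ^ b * (?P ^ Suc a - 1))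
        - ?s a b (\<mu>3 * inverse \<alpha> * q ^ b * (?P ^ a - 1))
        - (\<alpha> * q - inverse \<alpha>) *\<^sub>K ?s a b (\<mu>3 * ?P ^ a * q ^ b)"
      unfolding 6 basis_e_def V2_free_simps lin_ext_scale A B C R ..
    also have "\<dots> = 0"
      using nz by (simp add: pm_scale_simps single_diff[symmetric] field_simps)
    finally show ?thesis .
  qed
qed

lemma V2_gen_carrier:
  assumes "a < l1 \<alpha> \<beta>" "b < l2 \<alpha> \<beta>"
  shows "V2_gen \<alpha> \<beta> \<mu>1 \<mu>2 \<mu>3 g (a, b) \<in> V2_carrier \<alpha> \<beta>"
  using assms l1_pos cyc_add_less
  by (cases g) (auto simp: V2_carrier_def basis_e_def pm_scale_simps)

end

lemma V2_carrier_add: "u \<in> V2_carrier \<alpha> \<beta> \<Longrightarrow> v \<in> V2_carrier \<alpha> \<beta> \<Longrightarrow> u + v \<in> V2_carrier \<alpha> \<beta>"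
  using Poly_Mapping.keys_add[of u v] by (auto simp: V2_carrier_def)

lemma V2_carrier_zero: "0 \<in> V2_carrier \<alpha> \<beta>"
  by (simp add: V2_carrier_def)

lemma V2_carrier_scale: "v \<in> V2_carrier \<alpha> \<beta> \<Longrightarrow> c *\<^sub>K v \<in> V2_carrier \<alpha> \<beta>"
  by (auto simp: V2_carrier_def in_keys_iff)

lemma V2_carrier_sum:
  "(\<And>x. x \<in> A \<Longrightarrow> f x \<in> V2_carrier \<alpha> \<beta>) \<Longrightarrow> sum f A \<in> V2_carrier \<alpha> \<beta>"
  by (induction A rule: infinite_finite_induct)
    (auto intro: V2_carrier_add V2_carrier_zero)

lemma V2_free_carrier:
  assumes "root_of_unity \<alpha>" "root_of_unity \<beta>" and v: "v \<in> V2_carrier \<alpha> \<beta>"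
  shows "V2_free \<alpha> \<beta> \<mu>1 \<mu>2 \<mu>3 v f \<in> V2_carrier \<alpha> \<beta>"
proof -
  have 1: "lin_ext (V2_gen \<alpha> \<beta> \<mu>1 \<mu>2 \<mu>3 g) v \<in> V2_carrier \<alpha> \<beta>" if "v \<in> V2_carrier \<alpha> \<beta>" for g v
    unfolding lin_ext_def
  proof (intro V2_carrier_sum V2_carrier_scale)
    fix p assume "p \<in> Poly_Mapping.keys v"
    with that obtain a b where "p = (a, b)" "a < l1 \<alpha> \<beta>" "b < l2 \<alpha> \<beta>"
      by (auto simp: V2_carrier_def)
    then show "V2_gen \<alpha> \<beta> \<mu>1 \<mu>2 \<mu>3 g p \<in> V2_carrier \<alpha> \<beta>"
      using V2_gen_carrier assms(1,2) by blast
  qed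
  have "fold (\<lambda>g. lin_ext (V2_gen \<alpha> \<beta> \<mu>1 \<mu>2 \<mu>3 g)) xs v \<in> V2_carrier \<alpha> \<beta>" for xs
    using v by (induction xs arbitrary: v) (simp_all add: 1)
  then show ?thesis
    unfolding V2_free_def lin_ext_def V2_word_def by (intro V2_carrier_sum V2_carrier_scale)
qed

lemma ring_free_mat_alg: "ring (ring_of_type_algebra :: 'k::field free_mat_alg ring)"
proof -
  have "\<exists>y. x + y = 0" for x :: "'k free_mat_alg"
    using add.right_inverse by blast
  then show ?thesis
    unfolding ring_of_type_algebra_def using add.right_inverse
    by unfold_locales (auto simp: algebra_simps Units_def)
qed

lemma ideal_M2_relations:
  "ideal (Idl\<^bsub>ring_of_type_algebra\<^esub> (M2_relations \<alpha> \<beta>)) ring_of_type_algebra"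
  by (rule ring.genideal_ideal[OF ring_free_mat_alg]) (simp add: ring_of_type_algebra_def)

lemma V2_free_relations:
  fixes \<alpha> \<beta> :: "'k::field"
  assumes ru: "root_of_unity \<alpha>" "root_of_unity \<beta>" and \<mu>: "\<mu>1 \<noteq> 0" "\<mu>2 \<noteq> 0"
    and f: "f \<in> Idl\<^bsub>ring_of_type_algebra\<^esub> (M2_relations \<alpha> \<beta>)" and v: "v \<in> V2_carrier \<alpha> \<beta>"
  shows "V2_free \<alpha> \<beta> \<mu>1 \<mu>2 \<mu>3 v f = 0"
proof -
  interpret A: ring "ring_of_type_algebra :: 'k free_mat_alg ring" by (rule ring_free_mat_alg)
  let ?I = "{f. \<forall>v\<in>V2_carrier \<alpha> \<beta>. V2_free \<alpha> \<beta> \<mu>1 \<mu>2 \<mu>3 v f = 0}"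
  have neg: "\<ominus>\<^bsub>ring_of_type_algebra\<^esub> f = - f" for f :: "'k free_mat_alg"
    by (rule A.minus_equality) (simp_all add: ring_of_type_algebra_def)
  have "ideal ?I ring_of_type_algebra"
  proof (rule idealI)
    show "subgroup ?I (add_monoid ring_of_type_algebra)"
      using neg
      by unfold_locales (auto simp: ring_of_type_algebra_def V2_free_simps a_inv_def
          V2_free_def lin_ext_uminus lin_ext_add)
  qed (use ring_free_mat_alg in simp, auto simp: ring_of_type_algebra_def V2_free_mult V2_free_carrier ru)
  moreover have "V2_free \<alpha> \<beta> \<mu>1 \<mu>2 \<mu>3 v f = 0"
    if f: "f \<in> M2_relations \<alpha> \<beta>" and v: "v \<in> V2_carrier \<alpha> \<beta>" for f v
  proof -
    let ?lk = "Poly_Mapping.lookup v" and ?K = "Poly_Mapping.keys v"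
    have "v = (\<Sum>(a, b)\<in>?K. ?lk (a, b) *\<^sub>K basis_e a b)"
      using pm_expand[of v] by (simp add: basis_e_def pm_scale_simps case_prod_beta)
    then have "V2_free \<alpha> \<beta> \<mu>1 \<mu>2 \<mu>3 v f =
        V2_free \<alpha> \<beta> \<mu>1 \<mu>2 \<mu>3 (\<Sum>(a, b)\<in>?K. ?lk (a, b) *\<^sub>K basis_e a b) f"
      by simp
    also have "\<dots> = (\<Sum>(a, b)\<in>?K. ?lk (a, b) *\<^sub>K V2_free \<alpha> \<beta> \<mu>1 \<mu>2 \<mu>3 (basis_e a b) f)"
      by (simp add: V2_free_sum_left V2_free_scale_left case_prod_beta)
    also have "\<dots> = 0"
    proof (rule sum.neutral, clarify)
      fix a b assume "(a, b) \<in> ?K"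
      then have "a < l1 \<alpha> \<beta>" "b < l2 \<alpha> \<beta>" using v by (auto simp: V2_carrier_def)
      then show "?lk (a, b) *\<^sub>K V2_free \<alpha> \<beta> \<mu>1 \<mu>2 \<mu>3 (basis_e a b) f = 0"
        using V2_relations_basis[OF ru _ _ f \<mu>] by (simp add: pm_scale_simps)
    qed
    finally show ?thesis .
  qed
  ultimately have "Idl\<^bsub>ring_of_type_algebra\<^esub> (M2_relations \<alpha> \<beta>) \<subseteq> ?I"
    by (intro A.genideal_minimal) auto
  then show ?thesis using f v by auto
qed

lemma M2_cases:
  assumes "C \<in> carrier (M2 \<alpha> \<beta>)"
  obtains f where "C = Idl\<^bsub>ring_of_type_algebra\<^esub> (M2_relations \<alpha> \<beta>) +>\<^bsub>ring_of_type_algebra\<^esub> f"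
  using assms by (auto simp: M2_def FactRing_def A_RCOSETS_def')

lemma V2_ract_coset:
  assumes "root_of_unity \<alpha>" "root_of_unity \<beta>" "\<mu>1 \<noteq> 0" "\<mu>2 \<noteq> 0" "v \<in> V2_carrier \<alpha> \<beta>"
  shows "ract (V2 \<alpha> \<beta> \<mu>1 \<mu>2 \<mu>3) v (Idl\<^bsub>ring_of_type_algebra\<^esub> (M2_relations \<alpha> \<beta>) +>\<^bsub>ring_of_type_algebra\<^esub> f)
    = V2_free \<alpha> \<beta> \<mu>1 \<mu>2 \<mu>3 v f"
proof -
  let ?I = "Idl\<^bsub>ring_of_type_algebra\<^esub> (M2_relations \<alpha> \<beta>)"
  have c: "?I +>\<^bsub>ring_of_type_algebra\<^esub> f = (\<lambda>h. h + f) ` ?I"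
    by (auto simp: a_r_coset_def' ring_of_type_algebra_def)
  have "?I \<noteq> {}"
    using additive_subgroup.zero_closed[OF ideal.axioms(1)[OF ideal_M2_relations]] by blast
  then have "V2_free \<alpha> \<beta> \<mu>1 \<mu>2 \<mu>3 v ` (?I +>\<^bsub>ring_of_type_algebra\<^esub> f) = {V2_free \<alpha> \<beta> \<mu>1 \<mu>2 \<mu>3 v f}"
    unfolding c image_image using assms by (auto simp: V2_free_add_right V2_free_relations)
  then show ?thesis by (simp add: V2_def)
qed

lemma V2_right_module:
  fixes \<alpha> \<beta> :: "'k::field"
  assumes "root_of_unity \<alpha>" "root_of_unity \<beta>" "\<mu>1 \<noteq> 0" "\<mu>2 \<noteq> 0"
  shows "right_module (M2 \<alpha> \<beta>) (V2 \<alpha> \<beta> \<mu>1 \<mu>2 \<mu>3)"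
proof -
  let ?A = "ring_of_type_algebra :: 'k free_mat_alg ring"
  let ?I = "Idl\<^bsub>?A\<^esub> (M2_relations \<alpha> \<beta>)" and ?V = "V2 \<alpha> \<beta> \<mu>1 \<mu>2 \<mu>3"
  interpret I: ideal ?I ?A by (rule ideal_M2_relations)
  note act = V2_ract_coset[OF assms]
  have carr: "carrier ?A = UNIV" and ops: "f \<oplus>\<^bsub>?A\<^esub> g = f + g" "f \<otimes>\<^bsub>?A\<^esub> g = f * g" "\<one>\<^bsub>?A\<^esub> = 1" for f g
    by (simp_all add: ring_of_type_algebra_def)
  have add: "(?I +>\<^bsub>?A\<^esub> f) \<oplus>\<^bsub>M2 \<alpha> \<beta>\<^esub> (?I +>\<^bsub>?A\<^esub> g) = ?I +>\<^bsub>?A\<^esub> (f + g)"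
    and mul: "(?I +>\<^bsub>?A\<^esub> f) \<otimes>\<^bsub>M2 \<alpha> \<beta>\<^esub> (?I +>\<^bsub>?A\<^esub> g) = ?I +>\<^bsub>?A\<^esub> (f * g)"
    and one: "\<one>\<^bsub>M2 \<alpha> \<beta>\<^esub> = ?I +>\<^bsub>?A\<^esub> scalar 1" for f g
    using I.a_rcos_sum[of f g] I.rcoset_mult_add[of f g]
    by (simp_all add: M2_def FactRing_def carr ops scalar_def)
  have V: "carrier ?V = V2_carrier \<alpha> \<beta>" "u \<oplus>\<^bsub>?V\<^esub> v = u + v" "\<zero>\<^bsub>?V\<^esub> = 0" for u v
    by (simp_all add: V2_def)
  have "ring (M2 \<alpha> \<beta>)"
    unfolding M2_def by (rule I.quotient_is_ring)
  moreover have "abelian_group ?V"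
  proof (rule abelian_groupI, unfold V)
    fix v assume v: "v \<in> V2_carrier \<alpha> \<beta>"
    show "\<exists>u\<in>V2_carrier \<alpha> \<beta>. u + v = 0"
      using V2_carrier_scale[OF v, of "-1"] by (intro bexI[of _ "- v"]) (auto simp: pm_scale_minus)
  qed (auto simp: V2_carrier_add V2_carrier_zero add_ac)
  moreover have "right_module_axioms (M2 \<alpha> \<beta>) ?V"
    by unfold_locales
      (auto elim!: M2_cases simp: V act add mul one V2_free_carrier[OF assms(1,2)] V2_carrier_add
        V2_free_simps pm_scale_simps)
  ultimately show ?thesis by (simp add: right_module_def)
qed

end

theory Submission
  imports Defs
begin

text \<open>
  Let \<open>L = l1\<close>, \<open>M = l2\<close>. On \<open>V2\<close> the elements \<open>X12 X21\<close>, \<open>X21 ^ M\<close> and \<open>X22 ^ L\<close> act diagonally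
  in the basis \<open>e(a, b)\<close>, and the kernel of \<open>X11\<close> is spanned by the \<open>e(a, b)\<close> with \<open>(\<alpha>\<beta>)^a = 1\<close>,
  i.e. \<open>a = 0\<close> or \<open>a = ord (\<alpha>\<beta>)\<close>. An isomorphism maps \<open>e(0, 0)\<close> to a nonzero joint eigenvector in
  that kernel; comparing eigenvalues at any \<open>e(u, v)\<close> of its support gives the three conditions.
  Conversely, these are what is needed for \<open>e(0, 0) \<mapsto> e(u, v)\<close> to extend to a homomorphism,
  which then permutes the basis up to nonzero scalars.
\<close>

section \<open>Linear maps that send basis vectors to multiples of basis vectors\<close>

lemma lin_ext_cong:
  assumes "\<And>b. b \<in> Poly_Mapping.keys v \<Longrightarrow> S b = T b"
  shows "lin_ext S v = lin_ext T v"
  unfolding lin_ext_def using assms by (intro sum.cong) auto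

lemma lin_ext_comp: "lin_ext S (lin_ext T v) = lin_ext (\<lambda>b. lin_ext S (T b)) v"
  by (simp add: lin_ext_def[of T] lin_ext_def[of "\<lambda>b. lin_ext S (T b)"] lin_ext_sum lin_ext_scale)

lemma lin_ext_id: "lin_ext (\<lambda>b. Poly_Mapping.single b 1) v = v"
  using pm_expand[of v] by (simp add: lin_ext_def pm_scale_simps)

lemma keys_lin_ext_single:
  assumes "\<sigma> ` A \<subseteq> B" "Poly_Mapping.keys v \<subseteq> A"
  shows "Poly_Mapping.keys (lin_ext (\<lambda>b. Poly_Mapping.single (\<sigma> b) (c b)) v) \<subseteq> B"
proof
  fix y assume "y \<in> Poly_Mapping.keys (lin_ext (\<lambda>b. Poly_Mapping.single (\<sigma> b) (c b)) v)"
  then have "(\<Sum>b\<in>Poly_Mapping.keys v. Poly_Mapping.lookup v b * (c b when \<sigma> b = y)) \<noteq> 0"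
    by (simp add: in_keys_iff lin_ext_def lookup_sum lookup_single)
  then obtain b where "b \<in> Poly_Mapping.keys v" "\<sigma> b = y"
    by (rule sum.not_neutral_contains_not_neutral) (auto simp: when_def split: if_splits)
  then show "y \<in> B" using assms by auto
qed

text \<open>The inverse is a map of the same shape: it uses the inverse of \<open>\<sigma>\<close>
  on the indices and the reciprocal coefficients. This makes the explicit homomorphism constructed
  below an isomorphism.\<close>

lemma bij_betw_lin_ext_single:
  fixes \<sigma> :: "'b \<Rightarrow> 'c" and c :: "'b \<Rightarrow> 'k::field"
  assumes \<sigma>: "bij_betw \<sigma> A B" and c: "\<And>b. b \<in> A \<Longrightarrow> c b \<noteq> 0"
  shows "bij_betw (lin_ext (\<lambda>b. Poly_Mapping.single (\<sigma> b) (c b)))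
    {v. Poly_Mapping.keys v \<subseteq> A} {v. Poly_Mapping.keys v \<subseteq> B}"
proof -
  define \<tau> where "\<tau> = inv_into A \<sigma>"
  have \<tau>: "\<tau> ` B \<subseteq> A" "\<And>b. b \<in> A \<Longrightarrow> \<tau> (\<sigma> b) = b" "\<And>b. b \<in> B \<Longrightarrow> \<sigma> (\<tau> b) = b"
    using \<sigma> by (auto simp: \<tau>_def bij_betw_def inv_into_into f_inv_into_f)
  have \<sigma>B: "\<sigma> ` A \<subseteq> B" using \<sigma> by (auto simp: bij_betw_def)
  let ?F = "lin_ext (\<lambda>b. Poly_Mapping.single (\<sigma> b) (c b))"
  let ?G = "lin_ext (\<lambda>b. Poly_Mapping.single (\<tau> b) (inverse (c (\<tau> b))))"
  show ?thesis
  proof (rule bij_betw_byWitness[where f' = ?G])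
    show "\<forall>v\<in>{v. Poly_Mapping.keys v \<subseteq> A}. ?G (?F v) = v"
    proof clarify
      fix v :: "'b \<Rightarrow>\<^sub>0 'k" assume v: "Poly_Mapping.keys v \<subseteq> A"
      have "?G (?F v) = lin_ext (\<lambda>b. Poly_Mapping.single b 1) v"
        unfolding lin_ext_comp
        by (rule lin_ext_cong) (use v c \<tau> in \<open>auto simp: pm_scale_simps subset_iff\<close>)
      then show "?G (?F v) = v" by (simp add: lin_ext_id)
    qed
    show "\<forall>v\<in>{v. Poly_Mapping.keys v \<subseteq> B}. ?F (?G v) = v"
    proof clarify
      fix v :: "'c \<Rightarrow>\<^sub>0 'k" assume v: "Poly_Mapping.keys v \<subseteq> B"
      have "?F (?G v) = lin_ext (\<lambda>b. Poly_Mapping.single b 1) v"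
        unfolding lin_ext_comp
        by (rule lin_ext_cong) (use v c \<tau> in \<open>auto simp: pm_scale_simps subset_iff\<close>)
      then show "?F (?G v) = v" by (simp add: lin_ext_id)
    qed
  qed (simp_all add: image_subset_iff keys_lin_ext_single[OF \<sigma>B] keys_lin_ext_single[OF \<tau>(1)])
qed

section \<open>Cyclic shifts of the indices\<close>

lemma bij_betw_add_mod:
  fixes n u :: nat
  assumes "0 < n"
  shows "bij_betw (\<lambda>a. (a + u) mod n) {..<n} {..<n}"
proof -
  \<comment> \<open>\<open>k\<close> represents the negative of \<open>u\<close> modulo
    \<open>n\<close> as a natural number, so shifting by \<open>k\<close> undoes shifting by
    \<open>u\<close>.\<close>
  define k where "k = n - u mod n"
  have "u + k = n * (u div n + 1)"
    unfolding k_def using mult_div_mod_eq[of n u] mod_le_divisor[OF assms, of u] by (simp only: distrib_left)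
  then have *: "(a + (u + k)) mod n = a mod n" for a by (simp only: mod_mult_self2)
  have **: "((a + u) mod n + k) mod n = a mod n" "((a + k) mod n + u) mod n = a mod n" for a
    using *[of a] by (simp_all only: mod_add_left_eq add.assoc add.commute[of k u])
  show ?thesis
    by (rule bij_betw_byWitness[where f' = "\<lambda>a. (a + k) mod n"]) (use assms in \<open>auto simp: **\<close>)
qed

lemma power_mod_eq_one:
  fixes x :: "'a::monoid_mult"
  assumes "x ^ n = 1"
  shows "x ^ (m mod n) = x ^ m"
proof -
  have "x ^ m = x ^ (n * (m div n) + m mod n)" by simp
  also have "\<dots> = x ^ (m mod n)" by (simp only: power_add power_mult assms power_one mult_1_left)
  finally show ?thesis ..
qed

text \<open>Both operations are translations modulo \<open>n\<close>, hence commute. For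
  \<open>k = 1\<close> and \<open>k = -1\<close> this says that shifting the second index by
  \<open>v\<close> respects the index moves of \<open>X21\<close> and \<open>X12\<close>.\<close>

lemma cyc_add_add_mod:
  assumes "0 < n"
  shows "cyc_add n ((b + v) mod n) k = (cyc_add n b k + v) mod n"
proof -
  have "int (cyc_add n b k) = (int b + k) mod int n" for b
    using assms by (simp add: cyc_add_def)
  then have "int (cyc_add n ((b + v) mod n) k) = int ((cyc_add n b k + v) mod n)"
    by (simp add: zmod_int mod_simps ac_simps)
  then show ?thesis by simp
qed

lemma power_int_minus_mult: "(\<alpha>::'k::field) powi (- int (b * n)) = inverse (\<alpha> ^ n) ^ b"
  by (simp only: power_int_minus power_int_of_nat power_inverse power_mult[symmetric] mult.commute)

section \<open>Reduction of module statements to basis vectors and generators\<close>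

lemma V2_free_eq_lin_ext:
  "V2_free \<alpha> \<beta> \<mu>1 \<mu>2 \<mu>3 v f = lin_ext (\<lambda>p. V2_free \<alpha> \<beta> \<mu>1 \<mu>2 \<mu>3 (Poly_Mapping.single p 1) f) v"
proof -
  have "v = (\<Sum>p\<in>Poly_Mapping.keys v. Poly_Mapping.lookup v p *\<^sub>K Poly_Mapping.single p 1)"
    using pm_expand[of v] by (simp add: pm_scale_simps)
  then show ?thesis
    by (metis (no_types, lifting) V2_free_scale_left V2_free_sum_left lin_ext_def sum.cong)
qed

text \<open>Eigenvalues can be read off coordinate by coordinate. Knowing the action for indices in
  range suffices for every \<open>p\<close>, since outside the range \<open>v\<close> and its image
  both have coefficient zero.\<close>

lemma lookup_V2_free_diagonal:
  fixes d :: "nat \<times> nat \<Rightarrow> 'k::field"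
  assumes v: "v \<in> V2_carrier \<alpha> \<beta>"
    and d: "\<And>a b. a < l1 \<alpha> \<beta> \<Longrightarrow> b < l2 \<alpha> \<beta> \<Longrightarrow>
      V2_free \<alpha> \<beta> \<mu>1 \<mu>2 \<mu>3 (Poly_Mapping.single (a, b) 1) f = Poly_Mapping.single (a, b) (d (a, b))"
  shows "Poly_Mapping.lookup (V2_free \<alpha> \<beta> \<mu>1 \<mu>2 \<mu>3 v f) p = d p * Poly_Mapping.lookup v p"
proof -
  have "V2_free \<alpha> \<beta> \<mu>1 \<mu>2 \<mu>3 v f = lin_ext (\<lambda>p. Poly_Mapping.single p (d p)) v"
    unfolding V2_free_eq_lin_ext[of _ _ _ _ _ v]
    by (rule lin_ext_cong) (use v d in \<open>auto simp: V2_carrier_def\<close>)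
  then show ?thesis
    by (auto simp: lin_ext_def lookup_sum lookup_single when_def in_keys_iff if_distrib mult.commute
        cong: if_cong)
qed

lemma V2_free_one [simp]: "V2_free \<alpha> \<beta> \<mu>1 \<mu>2 \<mu>3 v 1 = v"
  using V2_free_scalar[of \<alpha> \<beta> \<mu>1 \<mu>2 \<mu>3 v 1] by (simp add: scalar_def pm_scale_simps)

lemma V2_free_power:
  "V2_free \<alpha> \<beta> \<mu>1 \<mu>2 \<mu>3 v (var g ^ n) = (lin_ext (V2_gen \<alpha> \<beta> \<mu>1 \<mu>2 \<mu>3 g) ^^ n) v"
proof (induction n)
  case (Suc n)
  \<comment> \<open>In a right action the last factor acts last, which matches the outermost
    application in \<open>^^\<close>; hence the new factor is split off on the right.\<close>
  then show ?case by (simp only: power_Suc2 V2_free_mult V2_free_var) simp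
qed simp

text \<open>Commuting with generators on basis vectors extends to words by induction. The induction
  also needs the carrier to be stable under generators, because \<open>gen\<close> speaks only of
  indices in range.\<close>

lemma V2_free_commute:
  assumes roots: "root_of_unity \<alpha>" "root_of_unity \<beta>"
    and gen: "\<And>g a b. a < l1 \<alpha> \<beta> \<Longrightarrow> b < l2 \<alpha> \<beta> \<Longrightarrow>
      lin_ext T (V2_gen \<alpha> \<beta> \<mu>1 \<mu>2 \<mu>3 g (a, b)) = lin_ext (V2_gen \<alpha> \<beta> \<nu>1 \<nu>2 \<nu>3 g) (T (a, b))"
    and v: "v \<in> V2_carrier \<alpha> \<beta>"
  shows "lin_ext T (V2_free \<alpha> \<beta> \<mu>1 \<mu>2 \<mu>3 v f) = V2_free \<alpha> \<beta> \<nu>1 \<nu>2 \<nu>3 (lin_ext T v) f"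
proof -
  have 1: "lin_ext T (lin_ext (V2_gen \<alpha> \<beta> \<mu>1 \<mu>2 \<mu>3 g) v) = lin_ext (V2_gen \<alpha> \<beta> \<nu>1 \<nu>2 \<nu>3 g) (lin_ext T v)"
    if "v \<in> V2_carrier \<alpha> \<beta>" for g v
    unfolding lin_ext_comp by (rule lin_ext_cong) (use that gen in \<open>auto simp: V2_carrier_def\<close>)
  have 2: "lin_ext (V2_gen \<alpha> \<beta> \<mu>1 \<mu>2 \<mu>3 g) v \<in> V2_carrier \<alpha> \<beta>" if "v \<in> V2_carrier \<alpha> \<beta>" for g v
    using V2_free_carrier[OF roots that, of \<mu>1 \<mu>2 \<mu>3 "var g"] by (simp add: V2_free_var)
  have "lin_ext T (fold (\<lambda>g. lin_ext (V2_gen \<alpha> \<beta> \<mu>1 \<mu>2 \<mu>3 g)) xs v) =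
      fold (\<lambda>g. lin_ext (V2_gen \<alpha> \<beta> \<nu>1 \<nu>2 \<nu>3 g)) xs (lin_ext T v)" for xs
    using v by (induction xs arbitrary: v) (simp_all add: 1 2)
  then show ?thesis
    by (simp add: V2_free_def lin_ext_def[of "V2_word _ _ _ _ _ _"] V2_word_def lin_ext_sum lin_ext_scale)
qed

lemma V2_simps:
  "carrier (V2 \<alpha> \<beta> \<mu>1 \<mu>2 \<mu>3) = V2_carrier \<alpha> \<beta>" "u \<oplus>\<^bsub>V2 \<alpha> \<beta> \<mu>1 \<mu>2 \<mu>3\<^esub> v = u + v"
  by (simp_all add: V2_def)

text \<open>A coset acts as any of its representatives, so homomorphisms can be tested against the
  free algebra, without cosets.\<close>

lemma rmod_hom_V2_iff:
  fixes \<alpha> \<beta> :: "'k::field"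
  assumes roots: "root_of_unity \<alpha>" "root_of_unity \<beta>"
    and nz: "\<mu>1 \<noteq> 0" "\<mu>2 \<noteq> 0" "\<nu>1 \<noteq> 0" "\<nu>2 \<noteq> 0"
  shows "F \<in> rmod_hom (M2 \<alpha> \<beta>) (V2 \<alpha> \<beta> \<mu>1 \<mu>2 \<mu>3) (V2 \<alpha> \<beta> \<nu>1 \<nu>2 \<nu>3) \<longleftrightarrow>
    F \<in> V2_carrier \<alpha> \<beta> \<rightarrow> V2_carrier \<alpha> \<beta> \<and>
    (\<forall>x\<in>V2_carrier \<alpha> \<beta>. \<forall>y\<in>V2_carrier \<alpha> \<beta>. F (x + y) = F x + F y) \<and>
    (\<forall>x\<in>V2_carrier \<alpha> \<beta>. \<forall>f. F (V2_free \<alpha> \<beta> \<mu>1 \<mu>2 \<mu>3 x f) = V2_free \<alpha> \<beta> \<nu>1 \<nu>2 \<nu>3 (F x) f)"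
proof -
  let ?A = "ring_of_type_algebra :: 'k free_mat_alg ring"
  let ?I = "Idl\<^bsub>?A\<^esub> (M2_relations \<alpha> \<beta>)"
  have coset: "?I +>\<^bsub>?A\<^esub> f \<in> carrier (M2 \<alpha> \<beta>)" for f
    by (auto simp: M2_def FactRing_def A_RCOSETS_def' ring_of_type_algebra_def)
  have "(\<forall>x\<in>V2_carrier \<alpha> \<beta>. \<forall>r\<in>carrier (M2 \<alpha> \<beta>).
      F (ract (V2 \<alpha> \<beta> \<mu>1 \<mu>2 \<mu>3) x r) = ract (V2 \<alpha> \<beta> \<nu>1 \<nu>2 \<nu>3) (F x) r) \<longleftrightarrow>
    (\<forall>x\<in>V2_carrier \<alpha> \<beta>. \<forall>f. F (V2_free \<alpha> \<beta> \<mu>1 \<mu>2 \<mu>3 x f) = V2_free \<alpha> \<beta> \<nu>1 \<nu>2 \<nu>3 (F x) f)"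
    (is "?l = ?r") if F: "F \<in> V2_carrier \<alpha> \<beta> \<rightarrow> V2_carrier \<alpha> \<beta>"
  proof -
    have "(F (ract (V2 \<alpha> \<beta> \<mu>1 \<mu>2 \<mu>3) x (?I +>\<^bsub>?A\<^esub> f)) =
        ract (V2 \<alpha> \<beta> \<nu>1 \<nu>2 \<nu>3) (F x) (?I +>\<^bsub>?A\<^esub> f)) \<longleftrightarrow>
      F (V2_free \<alpha> \<beta> \<mu>1 \<mu>2 \<mu>3 x f) = V2_free \<alpha> \<beta> \<nu>1 \<nu>2 \<nu>3 (F x) f"
      if x: "x \<in> V2_carrier \<alpha> \<beta>" for x f
      using V2_ract_coset[OF roots nz(1,2) x] V2_ract_coset[OF roots nz(3,4) funcset_mem[OF F x]]
      by simp
    then show ?thesis by (metis M2_cases coset)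
  qed
  then show ?thesis by (auto simp: rmod_hom_def V2_simps)
qed

section \<open>Explicit action on basis vectors\<close>

context
  fixes \<alpha> \<beta> :: "'k::field"
  assumes \<alpha>: "root_of_unity \<alpha>" and \<beta>: "root_of_unity \<beta>"
begin

text \<open>For \<open>X11\<close> the case \<open>a = 0\<close> is included: the truncated index
  \<open>a - 1\<close> is harmless because the factor \<open>(\<alpha> * \<beta>) ^ a - 1\<close>
  vanishes there.\<close>

lemma V2_gen_single:
  assumes "a < l1 \<alpha> \<beta>" "b < l2 \<alpha> \<beta>"
  shows "lin_ext (V2_gen \<alpha> \<beta> \<mu>1 \<mu>2 \<mu>3 X11) (Poly_Mapping.single (a, b) c) = Poly_Mapping.single (a - 1, b)
      (c * (inverse \<mu>1 * \<mu>3 * inverse \<alpha> * (inverse \<alpha> * \<beta>) ^ b * ((\<alpha> * \<beta>) ^ a - 1)))"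
    and "lin_ext (V2_gen \<alpha> \<beta> \<mu>1 \<mu>2 \<mu>3 X12) (Poly_Mapping.single (a, b) c) =
      Poly_Mapping.single (a, cyc_add (l2 \<alpha> \<beta>) b (-1)) (c * (inverse \<mu>2 * \<mu>3 * \<beta> ^ a * (inverse \<alpha> * \<beta>) ^ b))"
    and "lin_ext (V2_gen \<alpha> \<beta> \<mu>1 \<mu>2 \<mu>3 X21) (Poly_Mapping.single (a, b) c) =
      Poly_Mapping.single (a, cyc_add (l2 \<alpha> \<beta>) b 1) (c * (\<mu>2 * \<alpha> ^ a))"
    and "lin_ext (V2_gen \<alpha> \<beta> \<mu>1 \<mu>2 \<mu>3 X22) (Poly_Mapping.single (a, b) c) =
      (if Suc a = l1 \<alpha> \<beta> then Poly_Mapping.single (0, b) (c * (\<mu>1 * inverse (\<alpha> ^ l1 \<alpha> \<beta>) ^ b))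
       else Poly_Mapping.single (Suc a, b) (c * \<mu>1))"
proof -
  show "lin_ext (V2_gen \<alpha> \<beta> \<mu>1 \<mu>2 \<mu>3 X22) (Poly_Mapping.single (a, b) c) =
      (if Suc a = l1 \<alpha> \<beta> then Poly_Mapping.single (0, b) (c * (\<mu>1 * inverse (\<alpha> ^ l1 \<alpha> \<beta>) ^ b))
       else Poly_Mapping.single (Suc a, b) (c * \<mu>1))"
    using assms unfolding lin_ext_single V2_gen.simps power_int_minus_mult
    by (auto simp: basis_e_def pm_scale_simps)
qed (simp_all add: basis_e_def pm_scale_simps)

text \<open>The two cyclic moves cancel, and so do the factors \<open>\<mu>2\<close> and
  \<open>inverse \<mu>2\<close>; what remains is an eigenvalue that isolates
  \<open>\<mu>3\<close>.\<close>

lemma X12_X21_single: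
  assumes "a < l1 \<alpha> \<beta>" "b < l2 \<alpha> \<beta>" "\<mu>2 \<noteq> 0"
  shows "V2_free \<alpha> \<beta> \<mu>1 \<mu>2 \<mu>3 (Poly_Mapping.single (a, b) 1) (var X12 * var X21) =
    Poly_Mapping.single (a, b) (\<mu>3 * (\<alpha> * \<beta>) ^ a * (inverse \<alpha> * \<beta>) ^ b)"
  using assms cyc_add_less[OF \<alpha> \<beta>] params_nonzero[OF \<alpha> \<beta>]
  by (simp add: V2_free_simps V2_gen_single cyc_add_cancel[OF \<alpha> \<beta>] power_mult_distrib field_simps
      del: lin_ext_single)

lemma X21_power_single:
  assumes "a < l1 \<alpha> \<beta>" "b < l2 \<alpha> \<beta>"
  shows "V2_free \<alpha> \<beta> \<mu>1 \<mu>2 \<mu>3 (Poly_Mapping.single (a, b) 1) (var X21 ^ n) =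
    Poly_Mapping.single (a, (b + n) mod l2 \<alpha> \<beta>) ((\<mu>2 * \<alpha> ^ a) ^ n)"
proof (induction n)
  case (Suc n)
  have "cyc_add (l2 \<alpha> \<beta>) ((b + n) mod l2 \<alpha> \<beta>) 1 = Suc (b + n) mod l2 \<alpha> \<beta>"
    using l2_pos[OF \<alpha> \<beta>] by (simp add: cyc_add_1[OF \<alpha> \<beta>] mod_Suc)
  with Suc[unfolded V2_free_power] assms show ?case
    unfolding V2_free_power using l2_pos[OF \<alpha> \<beta>]
    by (simp add: V2_gen_single mult.commute del: lin_ext_single)
qed (use assms in simp)

text \<open>The bound on \<open>n\<close> allows at most one passage through the end of the cycle,
  so the extra factor occurs at most once. For \<open>n = l1 \<alpha> \<beta>\<close> it occurs
  exactly once and the action is diagonal.\<close>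

lemma X22_power_single:
  assumes "a < l1 \<alpha> \<beta>" "b < l2 \<alpha> \<beta>" "n \<le> l1 \<alpha> \<beta>"
  shows "V2_free \<alpha> \<beta> \<mu>1 \<mu>2 \<mu>3 (Poly_Mapping.single (a, b) 1) (var X22 ^ n) =
    (if a + n < l1 \<alpha> \<beta> then Poly_Mapping.single (a + n, b) (\<mu>1 ^ n)
     else Poly_Mapping.single (a + n - l1 \<alpha> \<beta>, b) (\<mu>1 ^ n * inverse (\<alpha> ^ l1 \<alpha> \<beta>) ^ b))"
  using assms(3)
proof (induction n)
  case (Suc n)
  then show ?case
    unfolding V2_free_power using assms(1,2)
    by (auto simp: V2_gen_single mult_ac Suc_diff_le simp del: lin_ext_single)
qed (use assms in simp)

text \<open>\<open>X11\<close> sends basis vectors with distinct indices and \<open>a > 0\<close> to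
  multiples of distinct basis vectors and kills those with \<open>a = 0\<close>. Hence no
  cancellation occurs, and each \<open>e(a, b)\<close> in the support of a kernel vector has
  coefficient zero under \<open>X11\<close>.\<close>

lemma X11_kernel:
  assumes nz: "\<mu>1 \<noteq> 0" "\<mu>3 \<noteq> 0" and v: "v \<in> V2_carrier \<alpha> \<beta>"
    and ker: "lin_ext (V2_gen \<alpha> \<beta> \<mu>1 \<mu>2 \<mu>3 X11) v = 0"
    and ab: "(a, b) \<in> Poly_Mapping.keys v"
  shows "(\<alpha> * \<beta>) ^ a = 1"
proof (cases a)
  case (Suc a')
  let ?d = "inverse \<mu>1 * \<mu>3 * inverse \<alpha> * (inverse \<alpha> * \<beta>) ^ b * ((\<alpha> * \<beta>) ^ a - 1)"
  have "0 = Poly_Mapping.lookup (lin_ext (V2_gen \<alpha> \<beta> \<mu>1 \<mu>2 \<mu>3 X11) v) (a', b)"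
    by (simp add: ker)
  also have "\<dots> = (\<Sum>p\<in>Poly_Mapping.keys v. if p = (a, b) then Poly_Mapping.lookup v (a, b) * ?d else 0)"
    unfolding lin_ext_def lookup_sum lookup_pm_scale
  proof (rule sum.cong[OF refl])
    fix p
    show "Poly_Mapping.lookup v p * Poly_Mapping.lookup (V2_gen \<alpha> \<beta> \<mu>1 \<mu>2 \<mu>3 X11 p) (a', b) =
        (if p = (a, b) then Poly_Mapping.lookup v (a, b) * ?d else 0)"
      by (cases p) (auto simp: Suc basis_e_def lookup_single when_def)
  qed
  also have "\<dots> = Poly_Mapping.lookup v (a, b) * ?d" using ab by simp
  finally show ?thesis using ab nz params_nonzero[OF \<alpha> \<beta>] by (auto simp: in_keys_iff)
qed simp

section \<open>The two implications, with natural numbers as parameters\<close>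

lemma V2_isomorphicD:
  assumes nz: "\<mu>1 \<noteq> 0" "\<mu>2 \<noteq> 0" "\<nu>1 \<noteq> 0" "\<nu>2 \<noteq> 0" "\<nu>3 \<noteq> 0"
    and iso: "rmod_isomorphic (M2 \<alpha> \<beta>) (V2 \<alpha> \<beta> \<mu>1 \<mu>2 \<mu>3) (V2 \<alpha> \<beta> \<nu>1 \<nu>2 \<nu>3)"
  obtains u v where "u < l1 \<alpha> \<beta>" "v < l2 \<alpha> \<beta>" "(\<alpha> * \<beta>) ^ u = 1"
    "\<mu>1 ^ l1 \<alpha> \<beta> = \<nu>1 ^ l1 \<alpha> \<beta> * inverse (\<alpha> ^ l1 \<alpha> \<beta>) ^ v"
    "\<mu>2 ^ l2 \<alpha> \<beta> = \<nu>2 ^ l2 \<alpha> \<beta> * \<alpha> ^ (u * l2 \<alpha> \<beta>)"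
    "\<mu>3 = \<nu>3 * (inverse \<alpha> * \<beta>) ^ v"
proof -
  let ?V = "V2_carrier \<alpha> \<beta>" and ?e = "Poly_Mapping.single (0, 0) 1 :: nat \<times> nat \<Rightarrow>\<^sub>0 'k"
  let ?M = "V2_free \<alpha> \<beta> \<mu>1 \<mu>2 \<mu>3" and ?N = "V2_free \<alpha> \<beta> \<nu>1 \<nu>2 \<nu>3"
  note pos = l1_pos[OF \<alpha> \<beta>] l2_pos[OF \<alpha> \<beta>]
  obtain F where F: "F \<in> ?V \<rightarrow> ?V" and Fadd: "\<And>x y. x \<in> ?V \<Longrightarrow> y \<in> ?V \<Longrightarrow> F (x + y) = F x + F y"
    and Fact: "\<And>x f. x \<in> ?V \<Longrightarrow> F (?M x f) = ?N (F x) f" and inj: "inj_on F ?V"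
    using iso by (auto simp: rmod_isomorphic_def rmod_hom_V2_iff[OF \<alpha> \<beta> nz(1-4)] V2_simps bij_betw_def)
  have F0: "F 0 = 0" using Fadd[OF V2_carrier_zero V2_carrier_zero] by simp
  have e: "?e \<in> ?V" using pos by (simp add: V2_carrier_def)
  define w where "w = F ?e"
  have w: "w \<in> ?V" using F e by (auto simp: w_def)
  have act: "F (?M ?e f) = ?N w f" for f using Fact[OF e] by (simp add: w_def)
  \<comment> \<open>\<open>F\<close> is only known to be additive and compatible with the action;
    its homogeneity comes from the algebra element \<open>scalar c\<close>.\<close>
  have eigen: "?N w f = c *\<^sub>K w" if "?M ?e f = Poly_Mapping.single (0, 0) c" for f c
    using that act[of f] act[of "scalar c"] by (simp add: V2_free_scalar pm_scale_simps)
  have "w \<noteq> 0"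
  proof
    assume "w = 0"
    then have "?e = 0" by (intro inj_onD[OF inj _ e V2_carrier_zero]) (simp add: w_def F0)
    then have "Poly_Mapping.lookup ?e (0, 0) = 0" by simp
    then show False by simp
  qed
  then obtain u v where uv: "(u, v) \<in> Poly_Mapping.keys w"
    by (metis keys_eq_empty ex_in_conv surj_pair)
  have lt: "u < l1 \<alpha> \<beta>" "v < l2 \<alpha> \<beta>" using w uv by (auto simp: V2_carrier_def)
  \<comment> \<open>The coefficient of \<open>w\<close> at \<open>(u, v)\<close> is nonzero and is
    multiplied both by \<open>c\<close> and by \<open>d (u, v)\<close>.\<close>
  have compare: "c = d (u, v)"
    if "?M ?e f = Poly_Mapping.single (0, 0) c"
      and "\<And>a b. a < l1 \<alpha> \<beta> \<Longrightarrow> b < l2 \<alpha> \<beta> \<Longrightarrow>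
        ?N (Poly_Mapping.single (a, b) 1) f = Poly_Mapping.single (a, b) (d (a, b))" for c d f
    using lookup_V2_free_diagonal[OF w that(2), where p = "(u, v)"] eigen[OF that(1)] uv
    by (simp add: in_keys_iff)
  \<comment> \<open>\<open>e(0, 0)\<close> is an eigenvector of \<open>X11\<close> with eigenvalue
    \<open>0\<close>.\<close>
  have "?N w (var X11) = 0" using eigen[of "var X11" 0] pos
    by (simp add: V2_free_var V2_gen_single pm_scale_simps)
  then have u: "(\<alpha> * \<beta>) ^ u = 1"
    using X11_kernel[OF nz(3,5) w _ uv] by (simp add: V2_free_var)
  have "\<mu>3 = (\<lambda>(a, b). \<nu>3 * (\<alpha> * \<beta>) ^ a * (inverse \<alpha> * \<beta>) ^ b) (u, v)"
    by (rule compare[of "var X12 * var X21"]) (use X12_X21_single pos nz in auto)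
  then have 3: "\<mu>3 = \<nu>3 * (inverse \<alpha> * \<beta>) ^ v" using u by simp
  have "\<mu>2 ^ l2 \<alpha> \<beta> = (\<lambda>(a, b). (\<nu>2 * \<alpha> ^ a) ^ l2 \<alpha> \<beta>) (u, v)"
    by (rule compare[of "var X21 ^ l2 \<alpha> \<beta>"]) (use X21_power_single pos in auto)
  then have 2: "\<mu>2 ^ l2 \<alpha> \<beta> = \<nu>2 ^ l2 \<alpha> \<beta> * \<alpha> ^ (u * l2 \<alpha> \<beta>)"
    by (simp add: power_mult_distrib power_mult)
  have "\<mu>1 ^ l1 \<alpha> \<beta> = (\<lambda>(a, b). \<nu>1 ^ l1 \<alpha> \<beta> * inverse (\<alpha> ^ l1 \<alpha> \<beta>) ^ b) (u, v)"
    by (rule compare[of "var X22 ^ l1 \<alpha> \<beta>"]) (use X22_power_single pos in auto)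
  then show ?thesis using that[OF lt u _ 2 3] by simp
qed

text \<open>The map shifts the indices by \<open>(u, v)\<close>. The condition on
  \<open>\<mu>1\<close> makes it consistent around the \<open>X22\<close> cycle, the one on
  \<open>\<mu>2\<close> around the \<open>X21\<close> cycle, and the one on \<open>\<mu>3\<close>
  matches \<open>X11\<close> and \<open>X12\<close>. Since
  \<open>(\<alpha> * \<beta>) ^ u = 1\<close>, the factors
  \<open>(\<alpha> * \<beta>) ^ a - 1\<close> of \<open>X11\<close> are unchanged by the
  shift.\<close>

lemma V2_isomorphicI:
  assumes nz: "\<mu>1 \<noteq> 0" "\<mu>2 \<noteq> 0" "\<nu>1 \<noteq> 0" "\<nu>2 \<noteq> 0"
    and u: "u < l1 \<alpha> \<beta>" "(\<alpha> * \<beta>) ^ u = 1"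
    and \<mu>1: "\<mu>1 ^ l1 \<alpha> \<beta> = \<nu>1 ^ l1 \<alpha> \<beta> * inverse (\<alpha> ^ l1 \<alpha> \<beta>) ^ v"
    and \<mu>2: "\<mu>2 ^ l2 \<alpha> \<beta> = \<nu>2 ^ l2 \<alpha> \<beta> * \<alpha> ^ (u * l2 \<alpha> \<beta>)"
    and \<mu>3: "\<mu>3 = \<nu>3 * (inverse \<alpha> * \<beta>) ^ v"
  shows "rmod_isomorphic (M2 \<alpha> \<beta>) (V2 \<alpha> \<beta> \<mu>1 \<mu>2 \<mu>3) (V2 \<alpha> \<beta> \<nu>1 \<nu>2 \<nu>3)"
proof -
  define L M s q where "L = l1 \<alpha> \<beta>" and "M = l2 \<alpha> \<beta>" and "s = inverse (\<alpha> ^ L)" and "q = inverse \<alpha> * \<beta>"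
  \<comment> \<open>\<open>x\<close> and \<open>y\<close> are the ratios of target to source
    coefficients for one step of \<open>X22\<close> and, in row \<open>u\<close> of the target, of
    \<open>X21\<close>. The function \<open>h\<close> below is the factor picked up once the first
    index in the target has passed \<open>L\<close>.\<close>
  define x y where "x = \<nu>1 / \<mu>1" and "y = \<nu>2 * \<alpha> ^ u / \<mu>2"
  define h where "h = (\<lambda>a b. if L \<le> a + u then s ^ (b + v) else 1)"
  \<comment> \<open>The coefficients are forced by \<open>e(0, 0) X21 ^ b X22 ^ a = \<mu>2 ^ b \<mu>1 ^ a e(a, b)\<close>.\<close>
  define c where "c = (\<lambda>(a, b). y ^ b * x ^ a * h a b)"
  define \<sigma> where "\<sigma> = map_prod (\<lambda>a. (a + u) mod L) (\<lambda>b. (b + v) mod M)"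
  define T where "T = (\<lambda>p. Poly_Mapping.single (\<sigma> p) (c p))"
  note pos = l1_pos[OF \<alpha> \<beta>, folded L_def] l2_pos[OF \<alpha> \<beta>, folded M_def]
  note ab0 = params_nonzero[OF \<alpha> \<beta>]
  have sM: "s ^ M = 1"
    using pow_ab(1)[OF \<alpha> \<beta>] by (simp add: s_def L_def M_def power_inverse flip: power_mult)
  have qM: "q ^ M = 1" using pow_l2[OF \<alpha> \<beta>] by (simp add: q_def M_def)
  have pL: "(\<alpha> * \<beta>) ^ L = 1" using pow_l1[OF \<alpha> \<beta>] by (simp add: L_def)
  have nu1: "\<nu>1 ^ L * s ^ v = \<mu>1 ^ L" using \<mu>1 by (simp add: L_def s_def)
  \<comment> \<open>Thus \<open>y ^ b\<close> depends only on \<open>b\<close> modulo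
    \<open>M\<close>, as the wrap-around of the second index requires.\<close>
  have yM: "y ^ M = 1"
    using \<mu>2 nz ab0 by (simp add: y_def M_def power_mult_distrib power_divide power_mult)
  have s0: "s \<noteq> 0" and x0: "x \<noteq> 0" and y0: "y \<noteq> 0" using nz ab0 by (simp_all add: s_def x_def y_def)
  have xinv: "x * inverse \<nu>1 = inverse \<mu>1" using nz by (simp add: x_def field_simps)
  have \<nu>2: "\<nu>2 = \<mu>2 * y * inverse (\<alpha> ^ u)" using nz ab0 by (simp add: y_def)
  have \<mu>3: "\<mu>3 = \<nu>3 * q ^ v" using \<mu>3 by (simp add: q_def)
  have bu: "\<beta> ^ u = inverse (\<alpha> ^ u)" and bL: "\<beta> ^ L = inverse (\<alpha> ^ L)"
    using u(2) pL by (auto simp: power_mult_distrib intro!: inverse_unique[symmetric])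
  \<comment> \<open>Both \<open>a\<close> and \<open>u\<close> are below \<open>L\<close>, so
    reduction subtracts \<open>L\<close> at most once. Doing so multiplies powers of \<alpha> by
    \<open>s\<close> and, because \<open>(\<alpha> * \<beta>) ^ L = 1\<close>, powers of \<beta> by
    \<open>inverse s\<close>.\<close>
  have mod: "(a + u) mod L = (if L \<le> a + u then a + u - L else a + u)" if "a < L" for a
    using that u(1) by (auto simp: L_def mod_if le_mod_geq)
  have \<alpha>mod: "\<alpha> ^ ((a + u) mod L) = \<alpha> ^ a * \<alpha> ^ u * (if L \<le> a + u then s else 1)" if "a < L" for a
    using ab0 by (auto simp: mod[OF that] power_diff s_def power_add divide_inverse)
  have \<beta>mod: "\<beta> ^ ((a + u) mod L) = \<beta> ^ a * inverse (\<alpha> ^ u) * (if L \<le> a + u then inverse s else 1)"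
    if "a < L" for a
    using ab0 by (auto simp: mod[OF that] power_diff s_def power_add divide_inverse bu bL)
  have qmod: "q ^ ((b + v) mod M) = q ^ b * q ^ v" for b
    by (simp add: power_mod_eq_one[OF qM] power_add)
  have smod: "s ^ ((b + v) mod M) = s ^ b * s ^ v" for b
    by (simp add: power_mod_eq_one[OF sM] power_add)
  have pmod: "(\<alpha> * \<beta>) ^ ((a + u) mod L) = (\<alpha> * \<beta>) ^ a" for a
    by (simp add: power_mod_eq_one[OF pL] power_add u)
  have gen: "lin_ext T (V2_gen \<alpha> \<beta> \<mu>1 \<mu>2 \<mu>3 g (a, b)) = lin_ext (V2_gen \<alpha> \<beta> \<nu>1 \<nu>2 \<nu>3 g) (T (a, b))"
    if "a < L" "b < M" for g a b
  proof -
    have lt: "(a + u) mod L < l1 \<alpha> \<beta>" "(b + v) mod M < l2 \<alpha> \<beta>"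
      using pos by (simp_all add: L_def M_def)
    have "V2_gen \<alpha> \<beta> \<mu>1 \<mu>2 \<mu>3 g (a, b) = lin_ext (V2_gen \<alpha> \<beta> \<mu>1 \<mu>2 \<mu>3 g) (Poly_Mapping.single (a, b) 1)"
      for g by (simp add: pm_scale_simps)
    note G = this V2_gen_single[OF that[unfolded L_def M_def], folded L_def M_def, folded s_def q_def]
    have T: "T (a, b) = Poly_Mapping.single ((a + u) mod L, (b + v) mod M) (c (a, b))" for a b
      by (simp add: T_def \<sigma>_def)
    note H = V2_gen_single[OF lt, folded L_def M_def, folded s_def q_def] smod qmod pmod
      \<alpha>mod[OF that(1)] \<beta>mod[OF that(1)]
    note cyc = cyc_add_add_mod[OF pos(2)]
    note pow = pow_cyc_add[OF \<alpha> \<beta> that(2)[unfolded M_def], folded M_def, OF yM]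
      pow_cyc_add[OF \<alpha> \<beta> that(2)[unfolded M_def], folded M_def, OF sM]
    show ?thesis
    proof (cases g)
      case X11
      show ?thesis
      proof (cases "(\<alpha> * \<beta>) ^ a = 1")
        \<comment> \<open>Both sides vanish, also for \<open>a = 0\<close>.\<close>
        case True
        then show ?thesis unfolding X11 G T H by (simp add: pm_scale_simps)
      next
        case False
        then obtain a' where a: "a = Suc a'" by (cases a) auto
        \<comment> \<open>If the shifted index were \<open>0\<close>, then
          \<open>(\<alpha> * \<beta>) ^ a\<close> would be \<open>1\<close>. So the shift does not
          wrap between \<open>a - 1\<close> and \<open>a\<close>, and \<open>h\<close> agrees at
          both.\<close>
        have "(a + u) mod L \<noteq> 0" using False pmod[of a] by (metis power_0)
        then have "\<not> L = Suc (a' + u)" "(a' + u) mod L = (a + u) mod L - 1"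
          using that(1) mod[of a'] mod[of a] by (auto simp: a)
        then have h: "h a b = h a' b" and a': "a - 1 = a'" "(a + u) mod L - 1 = (a' + u) mod L"
          by (auto simp: h_def a le_Suc_eq)
        have "inverse \<mu>1 * \<mu>3 * inverse \<alpha> * q ^ b * (P - 1) * c (a', b) =
            c (a, b) * (inverse \<nu>1 * \<nu>3 * inverse \<alpha> * (q ^ b * q ^ v) * (P - 1))" for P
          unfolding c_def prod.case h unfolding a xinv[symmetric] \<mu>3 power_Suc by (simp only: mult_ac)
        then show ?thesis unfolding X11 G T H a'
          by (simp only: lin_ext_single T pm_scale_simps mult_1_left)
      qed
    next
      case X12
      have "inverse \<mu>2 * \<mu>3 * \<beta> ^ a * q ^ b * c (a, cyc_add M b (-1)) = c (a, b) *
          (inverse \<nu>2 * \<nu>3 * (\<beta> ^ a * inverse (\<alpha> ^ u) * (if L \<le> a + u then inverse s else 1)) * (q ^ b * q ^ v))"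
        unfolding c_def prod.case h_def power_add pow \<mu>3 \<nu>2 using ab0 y0 s0 by (simp add: field_simps)
      then show ?thesis unfolding X12 G T H cyc
        by (simp only: lin_ext_single T pm_scale_simps mult_1_left)
    next
      case X21
      have "\<mu>2 * \<alpha> ^ a * c (a, cyc_add M b 1) =
          c (a, b) * (\<nu>2 * (\<alpha> ^ a * \<alpha> ^ u * (if L \<le> a + u then s else 1)))"
        unfolding c_def prod.case h_def power_add pow \<nu>2 using ab0 by simp
      then show ?thesis unfolding X21 G T H cyc
        by (simp only: lin_ext_single T pm_scale_simps mult_1_left)
    next
      case X22
      show ?thesis
      proof (cases "Suc a = L")
        case True
        \<comment> \<open>This is \<open>nu1\<close> divided by \<open>\<mu>1 ^ (L - 1)\<close>,
          since here \<open>a = L - 1\<close>.\<close>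
        have *: "\<mu>1 = \<nu>1 * (s ^ v * x ^ a)"
          using nu1 nz by (simp add: True[symmetric] x_def field_simps)
        \<comment> \<open>For \<open>u = 0\<close> source and target wrap in the same step.
          Otherwise the target has wrapped earlier and now moves from \<open>u - 1\<close> to
          \<open>u\<close>, while \<open>h\<close> drops from \<open>s ^ (b + v)\<close> back to
          \<open>1\<close>.\<close>
        show ?thesis
        proof (cases "u = 0")
          case True
          with * that \<open>Suc a = L\<close> show ?thesis unfolding X22 G T H
            by (simp add: T c_def h_def pm_scale_simps power_add mult_ac)
        next
          case False
          with \<open>Suc a = L\<close> u(1) mod[OF that(1)]
          have "(a + u) mod L = u - 1" "L \<le> a + u" "u < L" "0 < u" by (auto simp: L_def)
          with * that \<open>Suc a = L\<close> show ?thesis unfolding X22 G T H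
            by (simp add: T c_def h_def pm_scale_simps power_add mult_ac)
        qed
      next
        case False
        \<comment> \<open>Only the target can wrap here, namely when \<open>Suc (a + u) = L\<close>;
          exactly there \<open>h\<close> changes from \<open>1\<close> to
          \<open>s ^ (b + v)\<close>.\<close>
        show ?thesis unfolding X22 G T H using False u(1) that nz mod[OF that(1)] mod[of "Suc a"]
          by (auto simp: T c_def h_def x_def pm_scale_simps L_def[symmetric] power_add mult_ac Suc_diff_le)
      qed
    qed
  qed
  have "bij_betw \<sigma> ({..<L} \<times> {..<M}) ({..<L} \<times> {..<M})"
    unfolding \<sigma>_def by (intro bij_betw_map_prod bij_betw_add_mod pos)
  then have bij: "bij_betw (lin_ext T) (V2_carrier \<alpha> \<beta>) (V2_carrier \<alpha> \<beta>)"
    unfolding T_def V2_carrier_def L_def[symmetric] M_def[symmetric]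
    by (rule bij_betw_lin_ext_single) (use x0 y0 s0 in \<open>auto simp: c_def h_def split: if_splits\<close>)
  have "lin_ext T \<in> rmod_hom (M2 \<alpha> \<beta>) (V2 \<alpha> \<beta> \<mu>1 \<mu>2 \<mu>3) (V2 \<alpha> \<beta> \<nu>1 \<nu>2 \<nu>3)"
    unfolding rmod_hom_V2_iff[OF \<alpha> \<beta> nz]
    using bij_betw_imp_funcset[OF bij] gen V2_free_commute[OF \<alpha> \<beta>]
    by (simp add: lin_ext_add L_def M_def)
  with bij show ?thesis unfolding rmod_isomorphic_def by (auto simp: V2_simps)
qed

end

section \<open>Integer parameters and the two admissible values of \<open>u\<close>\<close>

theorem theorem7p2:
  fixes \<alpha> \<beta> \<mu>1 \<mu>2 \<mu>3 \<nu>1 \<nu>2 \<nu>3 :: "'k::alg_closed_field"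
  assumes "root_of_unity \<alpha>" and "root_of_unity \<beta>" and "\<alpha> * \<beta> \<noteq> 1"
    and "\<mu>1 \<noteq> 0" and "\<mu>2 \<noteq> 0" and "\<mu>3 \<noteq> 0"
    and "\<nu>1 \<noteq> 0" and "\<nu>2 \<noteq> 0" and "\<nu>3 \<noteq> 0"
  shows "rmod_isomorphic (M2 \<alpha> \<beta>) (V2 \<alpha> \<beta> \<mu>1 \<mu>2 \<mu>3) (V2 \<alpha> \<beta> \<nu>1 \<nu>2 \<nu>3) \<longleftrightarrow>
    (\<exists>u v :: int.
      (u = 0 \<or> u = int (mult_ord (\<alpha> * \<beta>))) \<and> 0 \<le> v \<and> v \<le> int (l2 \<alpha> \<beta>) - 1 \<and>
      \<mu>1 ^ l1 \<alpha> \<beta> = \<nu>1 ^ l1 \<alpha> \<beta> * \<alpha> powi (- v * int (l1 \<alpha> \<beta>)) \<and>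
      \<mu>2 ^ l2 \<alpha> \<beta> = \<nu>2 ^ l2 \<alpha> \<beta> * \<alpha> powi (u * int (l2 \<alpha> \<beta>)) \<and>
      \<mu>3 = \<nu>3 * (\<alpha> * \<beta>) powi u * (inverse \<alpha> * \<beta>) powi v)"
  (is "?iso \<longleftrightarrow> (\<exists>u v. ?cond u v)")
proof -
  let ?r = "mult_ord (\<alpha> * \<beta>)"
  note roots = assms(1,2)
  have ab0: "\<alpha> * \<beta> \<noteq> 0" using params_nonzero[OF roots] by simp
  have pr: "(\<alpha> * \<beta>) ^ ?r = 1" using mult_ord_dvd_iff[OF ab0, of ?r] by simp
  have l1: "l1 \<alpha> \<beta> = ?r \<or> l1 \<alpha> \<beta> = 2 * ?r" by (simp add: l1_def)
  have powi: "\<alpha> powi (- int v * int n) = inverse (\<alpha> ^ n) ^ v"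
    "\<alpha> powi (int u * int n) = \<alpha> ^ (u * n)" for u v n
    using power_int_minus_mult[of \<alpha> v n] power_int_of_nat[of \<alpha> "u * n"] by simp_all
  \<comment> \<open>For both values of \<open>u\<close> the power of
    \<open>\<alpha> * \<beta>\<close> is \<open>1\<close>, so it disappears from the third
    equation.\<close>
  have cond: "?cond (int u) (int v) \<longleftrightarrow> (u = 0 \<or> u = ?r) \<and> v < l2 \<alpha> \<beta> \<and>
      \<mu>1 ^ l1 \<alpha> \<beta> = \<nu>1 ^ l1 \<alpha> \<beta> * inverse (\<alpha> ^ l1 \<alpha> \<beta>) ^ v \<and>
      \<mu>2 ^ l2 \<alpha> \<beta> = \<nu>2 ^ l2 \<alpha> \<beta> * \<alpha> ^ (u * l2 \<alpha> \<beta>) \<and>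
      \<mu>3 = \<nu>3 * (inverse \<alpha> * \<beta>) ^ v" for u v
    unfolding powi using pr by auto
  show ?thesis
  proof
    assume ?iso
    then obtain u v where uv: "u < l1 \<alpha> \<beta>" "v < l2 \<alpha> \<beta>" "(\<alpha> * \<beta>) ^ u = 1"
      and eqs: "\<mu>1 ^ l1 \<alpha> \<beta> = \<nu>1 ^ l1 \<alpha> \<beta> * inverse (\<alpha> ^ l1 \<alpha> \<beta>) ^ v"
        "\<mu>2 ^ l2 \<alpha> \<beta> = \<nu>2 ^ l2 \<alpha> \<beta> * \<alpha> ^ (u * l2 \<alpha> \<beta>)" "\<mu>3 = \<nu>3 * (inverse \<alpha> * \<beta>) ^ v"
      using V2_isomorphicD[OF roots assms(4,5,7-9)] by blast
    \<comment> \<open>As \<open>u\<close> is below \<open>l1 \<alpha> \<beta>\<close>, which is at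
      most \<open>2 * ?r\<close>, the only possible multiples of \<open>?r\<close> are
      \<open>0\<close> and \<open>?r\<close>.\<close>
    have "?r dvd u" using uv(3) mult_ord_dvd_iff[OF ab0] by simp
    then obtain k where k: "u = ?r * k" ..
    have "u < 2 * ?r" using uv(1) l1 by auto
    then have "k < 2" using k by simp
    then have "u = 0 \<or> u = ?r" using k by (auto simp: less_2_cases_iff)
    then show "\<exists>u v. ?cond u v" using cond[of u v] uv(2) eqs by blast
  next
    assume "\<exists>u v. ?cond u v"
    then obtain u v where uv: "?cond u v" by blast
    then obtain m n where "u = int m" "v = int n"
      by (metis nonneg_int_cases of_nat_0_le_iff order_refl)
    with uv have "?cond (int m) (int n)" by simp
    then have mn: "m = 0 \<or> m = ?r"
      and eqs: "\<mu>1 ^ l1 \<alpha> \<beta> = \<nu>1 ^ l1 \<alpha> \<beta> * inverse (\<alpha> ^ l1 \<alpha> \<beta>) ^ n"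
        "\<mu>2 ^ l2 \<alpha> \<beta> = \<nu>2 ^ l2 \<alpha> \<beta> * \<alpha> ^ (m * l2 \<alpha> \<beta>)" "\<mu>3 = \<nu>3 * (inverse \<alpha> * \<beta>) ^ n"
      unfolding cond by simp_all
    note I = V2_isomorphicI[OF roots assms(4,5,7,8) _ _ eqs(1) _ eqs(3)]
    show ?iso
    proof (cases "m < l1 \<alpha> \<beta>")
      case True
      then show ?thesis using I[OF _ _ eqs(2)] mn pr by auto
    next
      \<comment> \<open>Here \<open>l1 \<alpha> \<beta> = ?r\<close>, so \<open>m\<close> is out of
        range as a first index. But
        \<open>\<alpha> ^ (l1 \<alpha> \<beta> * l2 \<alpha> \<beta>) = 1\<close> turns the second
        equation into the one for \<open>u = 0\<close>.\<close>
      case False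
      then have "m = l1 \<alpha> \<beta>" using mn l1 l1_pos[OF roots] by auto
      then show ?thesis using I[of 0] eqs(2) pow_ab(1)[OF roots] l1_pos[OF roots] by simp
    qed
  qed
qed

end
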